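(* The $n$-dimensional ball is of Jensen-type for every $n\ge 2$. That is, if $B_n$ is an $n$-dimensional (closed Euclidean) ball with $n\ge 2$, then for every convex function $f\colon B_n\to\mathbb{R}$, $$\frac{1}{|B_n|}\int_{B_n} f(x)\,dx \le \frac{1}{|\partial B_n|}\int_{\partial B_n} f(x)\,dx .$$
   Context: A convex and closed shape $X$ is called of Jensen-type if for every convex function $f\colon X\to\mathbb{R}$ the inequality $\frac{1}{|X|}\int_X f(x)\,dx\le\frac{1}{|\partial X|}\int_{\partial X} f(x)\,dx$ is satisfied. Here $\partial X$ is the boundary of $X$, $|X|$ is the $n$-dimensional volume of $X\subset\mathbb{R}^n$, $|\partial X|$ is the $(n-1)$-dimensional surface measure of $\partial X$, and the integrals are taken with respect to these measures. *)

theory Defs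
  imports "HOL-Analysis.Analysis"
begin

text \<open>
  The \<open>k\<close>-dimensional Hausdorff measure, normalised so that on a \<open>k\<close>-dimensional Euclidean space
  it is Lebesgue measure.  Two pitfalls of the library are avoided: \<^const>\<open>diameter\<close> is
  meaningful only for bounded sets, and \<open>0 ^ 0 = 1\<close> must not let the empty set
  count when \<open>k = 0\<close>.
\<close>

definition hausdorff_gauge :: "nat \<Rightarrow> 'a::metric_space set \<Rightarrow> ennreal" where
  "hausdorff_gauge k C =
     (if C = {} then 0 else ennreal (unit_ball_vol (real k) * (diameter C / 2) ^ k))"

definition hausdorff_pre :: "nat \<Rightarrow> real \<Rightarrow> 'a::metric_space set \<Rightarrow> ennreal" where
  "hausdorff_pre k \<delta> A =
     (INF C\<in>{C :: nat \<Rightarrow> 'a set. A \<subseteq> (\<Union>i. C i) \<and> (\<forall>i. bounded (C i) \<and> diameter (C i) \<le> \<delta>)}.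
        \<Sum>i. hausdorff_gauge k (C i))"

definition hausdorff_outer :: "nat \<Rightarrow> 'a::metric_space set \<Rightarrow> ennreal" where
  "hausdorff_outer k A = (SUP \<delta>\<in>{0<..}. hausdorff_pre k \<delta> A)"

text \<open>The measure lives on the Caratheodory-measurable sets.\<close>

definition hausdorff_measure :: "nat \<Rightarrow> 'a::metric_space measure" where
  "hausdorff_measure k =
     measure_of UNIV (lambda_system UNIV UNIV (hausdorff_outer k)) (hausdorff_outer k)"

lemma hausdorff_pre_mono: "A \<subseteq> B \<Longrightarrow> hausdorff_pre k \<delta> A \<le> hausdorff_pre k \<delta> B"
  unfolding hausdorff_pre_def by (rule INF_superset_mono) auto

lemma hausdorff_pre_empty:
  "\<delta> > 0 \<Longrightarrow> hausdorff_pre k \<delta> ({} :: 'a::metric_space set) = 0"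
proof -
  assume "\<delta> > 0"
  then have "hausdorff_pre k \<delta> ({} :: 'a set) \<le> (\<Sum>i::nat. hausdorff_gauge k ({} :: 'a set))"
    unfolding hausdorff_pre_def by (intro INF_lower2[of "\<lambda>_. {}"]) auto
  then show ?thesis by (simp add: hausdorff_gauge_def)
qed

lemma hausdorff_pre_subadditive:
  fixes A :: "nat \<Rightarrow> 'a::metric_space set"
  shows "hausdorff_pre k \<delta> (\<Union>i. A i) \<le> (\<Sum>i. hausdorff_pre k \<delta> (A i))"
proof (rule ennreal_le_epsilon)
  fix e :: real
  assume e: "0 < e" and fin: "(\<Sum>i. hausdorff_pre k \<delta> (A i)) < top"
  have "\<exists>C. A i \<subseteq> (\<Union>j. C j) \<and> (\<forall>j::nat. bounded (C j) \<and> diameter (C j) \<le> \<delta>) \<and>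
      (\<Sum>j. hausdorff_gauge k (C j)) < hausdorff_pre k \<delta> (A i) + ennreal (e * (1 / 2) ^ Suc i)" for i
  proof -
    have "hausdorff_pre k \<delta> (A i) < top"
      using ennreal_suminf_lessD[OF fin, of i] .
    then have "hausdorff_pre k \<delta> (A i) < hausdorff_pre k \<delta> (A i) + ennreal (e * (1 / 2) ^ Suc i)"
      using e by (simp add: ennreal_add_left_cancel_less less_top)
    then show ?thesis
      unfolding hausdorff_pre_def[of k \<delta> "A i"] INF_less_iff by blast
  qed
  then obtain C where C: "\<And>i. A i \<subseteq> (\<Union>j. C i j)"
      "\<And>i j::nat. bounded (C i j) \<and> diameter (C i j) \<le> \<delta>"
      "\<And>i. (\<Sum>j. hausdorff_gauge k (C i j)) \<le> hausdorff_pre k \<delta> (A i) + ennreal (e * (1 / 2) ^ Suc i)"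
    by (metis less_imp_le)
  define D where "D = (\<lambda>(i, j). C i j) \<circ> prod_decode"
  have "(\<Union>i. A i) \<subseteq> (\<Union>n. D n)"
  proof
    fix x assume "x \<in> (\<Union>i. A i)"
    then obtain i j where "x \<in> C i j" using C(1) by blast
    then have "x \<in> D (prod_encode (i, j))" by (simp add: D_def)
    then show "x \<in> (\<Union>n. D n)" by blast
  qed
  then have "hausdorff_pre k \<delta> (\<Union>i. A i) \<le> (\<Sum>n. hausdorff_gauge k (D n))"
    unfolding hausdorff_pre_def using C(2)
    by (intro INF_lower) (auto simp: D_def split: prod.split)
  also have "\<dots> = (\<Sum>i. \<Sum>j. hausdorff_gauge k (C i j))"
    using suminf_ennreal_2dimen[of "\<lambda>i. \<Sum>j. hausdorff_gauge k (C i j)"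
        "\<lambda>(i, j). hausdorff_gauge k (C i j)"]
    by (simp add: D_def comp_def split_def)
  also have "\<dots> \<le> (\<Sum>i. hausdorff_pre k \<delta> (A i) + ennreal (e * (1 / 2) ^ Suc i))"
    by (intro suminf_le C(3)) auto
  also have "\<dots> = (\<Sum>i. hausdorff_pre k \<delta> (A i)) + (\<Sum>i. ennreal (e * (1 / 2) ^ Suc i))"
    by (subst suminf_add) auto
  also have "(\<Sum>i. ennreal (e * (1 / 2) ^ Suc i)) = ennreal e"
  proof -
    have "(\<lambda>i. e * (1 / 2) ^ Suc i) sums e"
      using sums_mult[OF power_half_series, of e] by (simp only: mult_1_right)
    then show ?thesis
      by (rule suminf_ennreal_eq[rotated]) (use e in auto)
  qed
  finally show "hausdorff_pre k \<delta> (\<Union>i. A i) \<le> (\<Sum>i. hausdorff_pre k \<delta> (A i)) + ennreal e" .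
qed

lemma outer_measure_space_hausdorff_outer:
  "outer_measure_space UNIV (hausdorff_outer k :: 'a::metric_space set \<Rightarrow> ennreal)"
proof -
  have "hausdorff_outer k ({} :: 'a set) = 0"
    by (simp add: hausdorff_outer_def hausdorff_pre_empty)
  moreover have "hausdorff_outer k A \<le> hausdorff_outer k B" if "A \<subseteq> B" for A B :: "'a set"
    unfolding hausdorff_outer_def by (intro SUP_mono) (use that hausdorff_pre_mono in blast)
  moreover have "hausdorff_outer k (\<Union>i. A i) \<le> (\<Sum>i. hausdorff_outer k (A i))"
    for A :: "nat \<Rightarrow> 'a set"
    unfolding hausdorff_outer_def
  proof (rule SUP_least)
    fix \<delta> :: real assume \<delta>: "\<delta> \<in> {0<..}"
    have "hausdorff_pre k \<delta> (\<Union>i. A i) \<le> (\<Sum>i. hausdorff_pre k \<delta> (A i))"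
      by (rule hausdorff_pre_subadditive)
    also have "\<dots> \<le> (\<Sum>i. SUP \<delta>\<in>{0<..}. hausdorff_pre k \<delta> (A i))"
      using \<delta> by (intro suminf_le SUP_upper) auto
    finally show "hausdorff_pre k \<delta> (\<Union>i. A i) \<le> (\<Sum>i. SUP \<delta>\<in>{0<..}. hausdorff_pre k \<delta> (A i))" .
  qed
  ultimately show ?thesis
    unfolding outer_measure_space_def positive_def increasing_def countably_subadditive_def
    by blast
qed

lemma measure_space_hausdorff:
  "measure_space UNIV (lambda_system UNIV UNIV (hausdorff_outer k))
     (hausdorff_outer k :: 'a::metric_space set \<Rightarrow> ennreal)"
  using sigma_algebra.caratheodory_lemma[OF sigma_algebra_Pow, of UNIV]
    outer_measure_space_hausdorff_outer[of k] by simp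

lemma space_hausdorff_measure [simp]: "space (hausdorff_measure k) = UNIV"
  by (simp add: hausdorff_measure_def)

lemma sets_hausdorff_measure:
  "sets (hausdorff_measure k :: 'a::metric_space measure) =
     lambda_system UNIV UNIV (hausdorff_outer k)"
  using measure_space_hausdorff[of k, where 'a = 'a]
  unfolding hausdorff_measure_def measure_space_def
  by (intro sigma_algebra.sets_measure_of_eq) blast

lemma emeasure_hausdorff_measure:
  "A \<in> sets (hausdorff_measure k :: 'a::metric_space measure) \<Longrightarrow>
     emeasure (hausdorff_measure k) A = hausdorff_outer k A"
  using measure_space_hausdorff[of k, where 'a = 'a]
  unfolding hausdorff_measure_def[of k] measure_space_def
  by (intro emeasure_measure_of_sigma)
     (auto simp: sets_hausdorff_measure[unfolded hausdorff_measure_def])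

text \<open>
  A convex function on a closed ball may have integral \<open>\<infinity>\<close>, where the Bochner
  integral returns \<open>0\<close>.  It is bounded below, so its integral over the ball or the sphere is an
  extended real in the usual sense.  It need not be measurable on the sphere; the
  \<open>nn_integral\<close> of a non-measurable function is the lower integral.
\<close>

definition ereal_integral :: "'a measure \<Rightarrow> ('a \<Rightarrow> real) \<Rightarrow> ereal" where
  "ereal_integral M f =
     enn2ereal (\<integral>\<^sup>+x. ennreal (f x) \<partial>M) - enn2ereal (\<integral>\<^sup>+x. ennreal (- f x) \<partial>M)"

lemma ereal_integral_eq_integral:
  assumes "integrable M f"
  shows "ereal_integral M f = ereal (integral\<^sup>L M f)"
proof -
  have "(\<integral>\<^sup>+x. ennreal (f x) \<partial>M) \<noteq> \<infinity>" "(\<integral>\<^sup>+x. ennreal (- f x) \<partial>M) \<noteq> \<infinity>"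
    using assms by (auto simp: real_integrable_def)
  then show ?thesis
    unfolding ereal_integral_def real_lebesgue_integral_def[OF assms]
    by (cases rule: ennreal2_cases[of "\<integral>\<^sup>+x. ennreal (f x) \<partial>M" "\<integral>\<^sup>+x. ennreal (- f x) \<partial>M"])
       (auto simp: enn2ereal_ennreal)
qed

abbreviation surface_measure :: "'a::euclidean_space measure" where
  "surface_measure \<equiv> hausdorff_measure (DIM('a) - 1)"

definition jensen_type :: "'a::euclidean_space set \<Rightarrow> bool" where
  "jensen_type X \<longleftrightarrow> convex X \<and> closed X \<and>
     (\<forall>f. convex_on X f \<longrightarrow>
        ereal (1 / measure lebesgue X) * ereal_integral (lebesgue_on X) f
        \<le> ereal (1 / measure surface_measure (frontier X)) *
            ereal_integral (restrict_space surface_measure (frontier X)) f)"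

end

theory Submission
  imports Defs
begin

text \<open>
  For \<open>y\<close> in the ball with centre \<open>c\<close>, the points \<open>y\<close> and \<open>c - (y - c)\<close> lie on the segment between the
  radial projection \<open>x\<close> of \<open>y\<close> and its antipode \<open>x'\<close>, symmetrically about \<open>c\<close>, so convexity gives
  \<open>f y + f (c - (y - c)) \<le> f x + f x'\<close>.  Integrating over the ball, both summands on each side
  contribute equally, and the right-hand side becomes an integral of \<open>f\<close> against the cone measure, the
  image of Lebesgue measure under radial projection.  The cone measure is a multiple of the surface
  measure because both are finite and invariant under reflections, hence give equal mass to balls of equal
  radius centred on the sphere; by an argument of Christensen this determines a measure up to a factor.
  For this the surface measure must be positive and finite, which follows by comparing coverings and
  packings of the sphere with Lebesgue measure.  As \<open>f\<close> need not be measurable on the sphere, it is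
  replaced there by its radial upper limits from the inside.
\<close>

section \<open>Measures determined by balls\<close>

text \<open>Tonelli for the indicator of the pairs \<open>(x, y)\<close> with \<open>y\<close> in
  \<open>U\<close> and \<open>dist x y < e\<close>. The condition is symmetric in \<open>x\<close>
  and \<open>y\<close>, so the inner integrals in the two orders are ball masses of \<open>M\<close>
  and of \<open>N\<close>.\<close>

lemma nn_integral_emeasure_ball_swap:
  fixes M N :: "'a::{metric_space, second_countable_topology} measure"
  assumes sets: "sets M = sets borel" "sets N = sets borel"
    and "sigma_finite_measure M" "sigma_finite_measure N"
    and U: "U \<in> sets borel"
  shows "(\<lambda>x. emeasure M (U \<inter> ball x e)) \<in> borel_measurable N" (is ?meas)
    and "(\<integral>\<^sup>+x. emeasure M (U \<inter> ball x e) \<partial>N) = (\<integral>\<^sup>+y. indicator U y * emeasure N (ball y e) \<partial>M)"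
      (is ?swap)
proof -
  interpret M: sigma_finite_measure M by fact
  interpret N: sigma_finite_measure N by fact
  interpret MN: pair_sigma_finite N M ..
  note [measurable_cong] = sets and [measurable] = U
  define h :: "'a \<Rightarrow> 'a \<Rightarrow> ennreal" where
    "h x y = indicator U y * indicator {z. dist (fst z) (snd z) < e} (x, y)" for x y
  have [measurable]: "case_prod h \<in> borel_measurable (N \<Otimes>\<^sub>M M)"
  proof -
    \<comment> \<open>Second countability enters here: only then do the Borel sets of the product
      form the product \<sigma>-algebra.\<close>
    have "open {z :: 'a \<times> 'a. dist (fst z) (snd z) < e}"
      by (intro open_Collect_less continuous_intros)
    then have "{z :: 'a \<times> 'a. dist (fst z) (snd z) < e} \<in> sets (borel \<Otimes>\<^sub>M borel)"
      unfolding borel_prod by simp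
    then have [measurable]: "{z :: 'a \<times> 'a. dist (fst z) (snd z) < e} \<in> sets (N \<Otimes>\<^sub>M M)"
      using sets by (simp cong: sets_pair_measure_cong)
    have "case_prod h = (\<lambda>z. indicator U (snd z) * indicator {z. dist (fst z) (snd z) < e} z)"
      by (auto simp: h_def)
    also have "\<dots> \<in> borel_measurable (N \<Otimes>\<^sub>M M)" by measurable
    finally show ?thesis .
  qed
  have h1: "(\<integral>\<^sup>+y. h x y \<partial>M) = emeasure M (U \<inter> ball x e)" for x
  proof -
    have "(\<integral>\<^sup>+y. h x y \<partial>M) = (\<integral>\<^sup>+y. indicator (U \<inter> ball x e) y \<partial>M)"
      by (intro nn_integral_cong) (auto simp: h_def indicator_def)
    then show ?thesis using U by (simp add: sets)
  qed
  have h2: "(\<integral>\<^sup>+x. h x y \<partial>N) = indicator U y * emeasure N (ball y e)" for y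
  proof -
    have "(\<integral>\<^sup>+x. h x y \<partial>N) = (\<integral>\<^sup>+x. indicator U y * indicator (ball y e) x \<partial>N)"
      by (intro nn_integral_cong) (auto simp: h_def indicator_def dist_commute)
    also have "\<dots> = indicator U y * (\<integral>\<^sup>+x. indicator (ball y e) x \<partial>N)"
      by (rule nn_integral_cmult) (rule borel_measurable_indicator, simp add: sets)
    finally show ?thesis by (simp add: sets)
  qed
  have "(\<lambda>x. \<integral>\<^sup>+y. h x y \<partial>M) \<in> borel_measurable N" by measurable
  then show ?meas unfolding h1 .
  have "(\<integral>\<^sup>+x. (\<integral>\<^sup>+y. h x y \<partial>M) \<partial>N) = (\<integral>\<^sup>+y. (\<integral>\<^sup>+x. h x y \<partial>N) \<partial>M)"
    by (rule MN.Fubini'[symmetric]) simp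
  then show ?swap unfolding h1 h2 .
qed

text \<open>
  By Fatou and the interchange of integrals above, \<open>N U\<close> is at most the lower limit as \<open>e\<close> tends to \<open>0\<close>
  of the integral of \<open>M (U \<inter> ball x e) / a e\<close> with respect to \<open>N\<close>, which is constantly \<open>M U\<close>.
\<close>
lemma emeasure_le_of_same_ball_measures:
  fixes M N :: "'a::{metric_space, second_countable_topology} measure"
  assumes sets: "sets M = sets borel" "sets N = sets borel"
    and sf: "sigma_finite_measure M" "sigma_finite_measure N"
    and supp: "AE x in M. x \<in> K" "AE x in N. x \<in> K"
    and balls: "\<And>x e. x \<in> K \<Longrightarrow> e > 0 \<Longrightarrow> emeasure M (ball x e) = a e"
               "\<And>x e. x \<in> K \<Longrightarrow> e > 0 \<Longrightarrow> emeasure N (ball x e) = a e"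
    and a: "\<And>e. e > 0 \<Longrightarrow> 0 < a e \<and> a e < \<infinity>"
    and U: "open U"
  shows "emeasure N U \<le> emeasure M U"
proof -
  have UB: "U \<in> sets borel" using U by simp
  define e :: "nat \<Rightarrow> real" where "e k = 1 / Suc k" for k
  have e: "e k > 0" for k by (simp add: e_def)
  let ?q = "\<lambda>k x. emeasure M (U \<inter> ball x (e k)) / a (e k)"
  note meas = nn_integral_emeasure_ball_swap(1)[OF sets sf UB]
  have int: "(\<integral>\<^sup>+x. ?q k x \<partial>N) = emeasure M U" for k
  proof -
    have "(\<integral>\<^sup>+x. emeasure M (U \<inter> ball x (e k)) \<partial>N) = (\<integral>\<^sup>+y. a (e k) * indicator U y \<partial>M)"
      using supp(1) unfolding nn_integral_emeasure_ball_swap(2)[OF sets sf UB]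
      by (intro nn_integral_cong_AE) (auto simp: balls e mult.commute)
    also have "\<dots> = a (e k) * emeasure M U" using UB by (simp add: nn_integral_cmult_indicator sets)
    finally have "(\<integral>\<^sup>+x. emeasure M (U \<inter> ball x (e k)) \<partial>N) / a (e k) = emeasure M U"
      using a[OF e[of k]] by (auto simp: ennreal_mult_divide_eq mult.commute[of "a (e k)"])
    then show ?thesis by (subst nn_integral_divide) (auto intro: meas)
  qed
  have "emeasure N U = (\<integral>\<^sup>+x. indicator U x \<partial>N)" using UB by (simp add: sets)
  also have "\<dots> \<le> (\<integral>\<^sup>+x. liminf (\<lambda>k. ?q k x) \<partial>N)"
  proof (intro nn_integral_mono_AE)
    have "indicator U x \<le> liminf (\<lambda>k. ?q k x)" if "x \<in> K" for x
    proof (cases "x \<in> U")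
      \<comment> \<open>A small ball around a point of the open set \<open>U\<close> lies inside
        \<open>U\<close>, so the quotient is eventually exactly 1.\<close>
      case True
      then obtain d where d: "d > 0" "ball x d \<subseteq> U" using U open_contains_ball by blast
      have "\<forall>\<^sub>F k in sequentially. e k < d"
        using LIMSEQ_inverse_real_of_nat d(1) unfolding e_def
        by (auto simp: inverse_eq_divide intro: order_tendstoD(2))
      then have "\<forall>\<^sub>F k in sequentially. 1 \<le> ?q k x"
      proof eventually_elim
        case (elim k)
        then have "U \<inter> ball x (e k) = ball x (e k)" using d by auto
        then show ?case using balls(1)[OF that e[of k]] a[OF e[of k]]
          by (auto simp: ennreal_divide_self)
      qed
      then show ?thesis using True by (auto intro: Liminf_bounded)
    qed simp
    then show "AE x in N. indicator U x \<le> liminf (\<lambda>k. ?q k x)"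
      using supp(2) by auto
  qed
  also have "\<dots> \<le> liminf (\<lambda>k. \<integral>\<^sup>+x. ?q k x \<partial>N)"
  proof (rule nn_integral_liminf)
    note [measurable] = meas
    show "(\<lambda>x. ?q k x) \<in> borel_measurable N" for k by measurable
  qed
  also have "\<dots> = emeasure M U" unfolding int by (simp add: Liminf_const)
  finally show ?thesis .
qed

lemma sigma_finite_measure_finite_on_balls:
  fixes M :: "'a::metric_space measure"
  assumes "sets M = sets borel" "\<And>x e. emeasure M (ball x e) < \<infinity>"
  shows "sigma_finite_measure M"
proof
  have "space M = UNIV" using sets_eq_imp_space_eq[OF assms(1)] by simp
  moreover have "(\<Union>k::nat. ball undefined (real k)) = (UNIV :: 'a set)"
    using reals_Archimedean2 by (auto simp: set_eq_iff)
  ultimately show "\<exists>A. countable A \<and> A \<subseteq> sets M \<and> \<Union> A = space M \<and> (\<forall>a\<in>A. emeasure M a \<noteq> \<infinity>)"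
    using assms by (intro exI[of _ "range (\<lambda>k::nat. ball undefined (real k))"]) (auto simp: less_top)
qed

text \<open>The preceding inequality in both directions gives equality on open sets. These are
  stable under intersection and generate the Borel sets, and balls of finite mass exhaust the
  space.\<close>

lemma measure_eqI_balls:
  fixes M N :: "'a::{metric_space, second_countable_topology} measure"
  assumes sets: "sets M = sets borel" "sets N = sets borel"
    and fin: "\<And>x e. emeasure M (ball x e) < \<infinity>" "\<And>x e. emeasure N (ball x e) < \<infinity>"
    and supp: "AE x in M. x \<in> K" "AE x in N. x \<in> K"
    and balls: "\<And>x e. x \<in> K \<Longrightarrow> e > 0 \<Longrightarrow> emeasure M (ball x e) = a e"
               "\<And>x e. x \<in> K \<Longrightarrow> e > 0 \<Longrightarrow> emeasure N (ball x e) = a e"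
    and a: "\<And>e. e > 0 \<Longrightarrow> 0 < a e \<and> a e < \<infinity>"
  shows "M = N"
proof (rule measure_eqI_generator_eq[where E="{U. open U}" and \<Omega>=UNIV and A="\<lambda>k. ball undefined (real k)"])
  note sf = sigma_finite_measure_finite_on_balls[OF sets(1) fin(1)]
    sigma_finite_measure_finite_on_balls[OF sets(2) fin(2)]
  show "emeasure M U = emeasure N U" if "U \<in> {U. open U}" for U
    using emeasure_le_of_same_ball_measures[OF sets sf supp balls a, of U]
      emeasure_le_of_same_ball_measures[OF sets(2,1) sf(2,1) supp(2,1) balls(2,1) a, of U] that
    by (auto intro: antisym)
  show "sets M = sigma_sets UNIV {U. open U}" "sets N = sigma_sets UNIV {U. open U}"
    using sets by (simp_all add: borel_def)
  show "(\<Union>k::nat. ball undefined (real k)) = (UNIV :: 'a set)"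
    using reals_Archimedean2 by (auto simp: set_eq_iff)
  show "Int_stable {U :: 'a set. open U}" by (auto simp: Int_stable_def)
  show "emeasure M (ball undefined (real k)) \<noteq> \<infinity>" for k using fin(1) by (simp add: less_top)
qed auto

text \<open>Each measure is uniform on \<open>K\<close>, but the common ball masses of
  \<open>M\<close> and \<open>N\<close> are not assumed to agree. Interchanging integrals over all
  pairs at distance below \<open>e\<close> shows that they are proportional to the total masses,
  which are equal.\<close>

lemma finite_measure_eqI_uniform:
  fixes M N :: "'a::{metric_space, second_countable_topology} measure"
  assumes sets: "sets M = sets borel" "sets N = sets borel"
    and fin: "finite_measure M" "finite_measure N"
    and K: "compact K"
    and supp: "AE x in M. x \<in> K" "AE x in N. x \<in> K"
    and unif: "\<And>x y e. x \<in> K \<Longrightarrow> y \<in> K \<Longrightarrow> emeasure M (ball x e) = emeasure M (ball y e)"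
              "\<And>x y e. x \<in> K \<Longrightarrow> y \<in> K \<Longrightarrow> emeasure N (ball x e) = emeasure N (ball y e)"
    and total: "emeasure M UNIV = emeasure N UNIV" "emeasure M UNIV \<noteq> 0"
  shows "M = N"
proof -
  interpret M: finite_measure M by fact
  interpret N: finite_measure N by fact
  have sp: "space M = UNIV" "space N = UNIV" using sets_eq_imp_space_eq[OF sets(1)] sets_eq_imp_space_eq[OF sets(2)] by simp_all
  have KB: "K \<in> sets M" using K by (simp add: sets compact_imp_closed)
  have MK: "emeasure M K = emeasure M UNIV"
    using supp(1) by (intro emeasure_eq_AE) (auto simp: KB sp[symmetric])
  then have "K \<noteq> {}" using total(2) by auto
  then obtain p where p: "p \<in> K" by blast
  have eq: "emeasure M (ball p e) = emeasure N (ball p e)" for e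
  proof -
    have *: "emeasure M UNIV * emeasure M (ball p e) = emeasure M UNIV * emeasure N (ball p e)"
    proof -
      have "emeasure M UNIV * emeasure M (ball p e) = (\<integral>\<^sup>+x. emeasure M (ball p e) \<partial>N)"
        by (simp add: sp total(1) mult.commute)
      also have "\<dots> = (\<integral>\<^sup>+x. emeasure M (UNIV \<inter> ball x e) \<partial>N)"
        using supp(2) p by (intro nn_integral_cong_AE) (auto intro: unif(1))
      also have "\<dots> = (\<integral>\<^sup>+y. indicator UNIV y * emeasure N (ball y e) \<partial>M)"
        by (intro nn_integral_emeasure_ball_swap sets M.sigma_finite_measure_axioms N.sigma_finite_measure_axioms) simp
      also have "\<dots> = (\<integral>\<^sup>+y. emeasure N (ball p e) \<partial>M)"
        using supp(1) p by (intro nn_integral_cong_AE) (auto intro: unif(2))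
      finally show ?thesis by (simp add: sp mult.commute)
    qed
    then show ?thesis using total(2) M.emeasure_finite[of UNIV]
      by (simp add: ennreal_mult_cancel_left)
  qed
  \<comment> \<open>If one ball of radius \<open>e\<close> were null, all would be by uniformity,
    and finitely many of them cover the compact set \<open>K\<close>, which carries the whole
    mass.\<close>
  have pos: "emeasure M (ball p e) > 0" if "e > 0" for e
  proof (rule ccontr)
    assume "\<not> emeasure M (ball p e) > 0"
    then have null: "emeasure M (ball x e) = 0" if "x \<in> K" for x using unif(1)[OF that p, of e] by simp
    have "K \<subseteq> (\<Union>x\<in>K. ball x e)" using \<open>e > 0\<close> by auto
    then obtain F where F: "finite F" "F \<subseteq> K" "K \<subseteq> (\<Union>x\<in>F. ball x e)"
      by (rule compactE_image[OF K open_ball])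
    have "emeasure M K \<le> emeasure M (\<Union>x\<in>F. ball x e)"
      by (rule emeasure_mono[OF F(3)]) (simp add: sets borel_open open_UN)
    also have "\<dots> \<le> (\<Sum>x\<in>F. emeasure M (ball x e))"
      by (rule emeasure_subadditive_finite) (use F in \<open>auto simp: sets\<close>)
    also have "\<dots> = 0" using null F(2) by (intro sum.neutral) auto
    finally show False using MK total(2) by simp
  qed
  show ?thesis
  proof (rule measure_eqI_balls[where K=K and a="\<lambda>e. emeasure M (ball p e)"])
    show "emeasure N (ball x e) = emeasure M (ball p e)" if "x \<in> K" for x e
      unfolding eq by (rule unif(2)[OF that p])
    show "emeasure M (ball x e) = emeasure M (ball p e)" if "x \<in> K" for x e
      by (rule unif(1)[OF that p])
    show "emeasure M (ball x e) < \<infinity>" "emeasure N (ball x e) < \<infinity>" for x e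
      by (simp_all flip: less_top)
    show "0 < emeasure M (ball p e) \<and> emeasure M (ball p e) < \<infinity>" if "e > 0" for e
      using pos[OF that] by (simp flip: less_top)
  qed (fact sets supp)+
qed

section \<open>Reflections and isometric involutions\<close>

text \<open>Reflection in the hyperplane through \<open>c\<close> with normal \<open>a\<close>; for
  \<open>a = 0\<close> it is the identity.\<close>

definition reflect_through :: "'a::real_inner \<Rightarrow> 'a \<Rightarrow> 'a \<Rightarrow> 'a" where
  "reflect_through a c x = x - (2 * ((x - c) \<bullet> a) / (a \<bullet> a)) *\<^sub>R a"

lemma reflect_through_involution [simp]: "reflect_through a c (reflect_through a c x) = x"
  by (cases "a = 0") (simp_all add: reflect_through_def inner_diff_left algebra_simps
      diff_divide_distrib add_divide_distrib flip: scaleR_add_left)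

lemma reflect_through_affine:
  "reflect_through a c (c + s *\<^sub>R (x - c)) = c + s *\<^sub>R (reflect_through a c x - c)"
  by (simp add: reflect_through_def algebra_simps)

lemma dist_reflect_through [simp]:
  "dist (reflect_through a c x) (reflect_through a c y) = dist x y"
proof (cases "a = 0")
  case False
  define u where "u = x - y"
  define s where "s = 2 * (u \<bullet> a) / (a \<bullet> a)"
  have "reflect_through a c x - reflect_through a c y = u - s *\<^sub>R a"
    by (simp add: reflect_through_def s_def u_def inner_diff_left algebra_simps diff_divide_distrib
        flip: scaleR_add_left)
  moreover have "(u - s *\<^sub>R a) \<bullet> (u - s *\<^sub>R a) = u \<bullet> u"
  proof -
    have "s * (a \<bullet> a) = 2 * (u \<bullet> a)" using False by (simp add: s_def)
    then have "(u - s *\<^sub>R a) \<bullet> (u - s *\<^sub>R a) = u \<bullet> u - 2 * s * (u \<bullet> a) + s * (2 * (u \<bullet> a))"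
      by (simp add: inner_diff_left inner_diff_right inner_commute)
    then show ?thesis by simp
  qed
  ultimately show ?thesis by (simp add: dist_norm norm_eq_sqrt_inner u_def)
qed (simp add: reflect_through_def)

text \<open>For \<open>u\<close> and \<open>v\<close> of equal length,
  \<open>2 * (u \<bullet> (u - v))\<close> is the squared length of \<open>u - v\<close>, so the
  coefficient in the reflection is 1. This yields an isometry that fixes the centre and exchanges
  two prescribed points of a sphere.\<close>

lemma reflect_through_swap:
  assumes "norm (x - c) = norm (y - c)"
  shows "reflect_through (x - y) c x = y"
proof (cases "x = y")
  case False
  define u v where "u = x - c" and "v = y - c"
  have "u \<bullet> u = v \<bullet> v" using assms by (simp add: u_def v_def norm_eq)
  then have "2 * (u \<bullet> (u - v)) = (u - v) \<bullet> (u - v)"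
    by (simp add: inner_diff_left inner_diff_right inner_commute)
  moreover have "u - v = x - y" by (simp add: u_def v_def)
  ultimately have eq: "2 * ((x - c) \<bullet> (x - y)) / ((x - y) \<bullet> (x - y)) = 1"
    using False by (metis divide_self inner_eq_zero_iff right_minus_eq u_def)
  show ?thesis unfolding reflect_through_def eq by simp
qed (simp add: reflect_through_def)

lemma vimage_ball_isometric_involution:
  assumes "\<And>x. T (T x) = x" "\<And>x y. dist (T x) (T y) = dist x y"
  shows "T -` ball x e = ball (T x) e"
  using assms by (auto simp: set_eq_iff) (metis)+

lemma continuous_on_isometric:
  assumes "\<And>x y. dist (T x) (T y) = dist x y"
  shows "continuous_on A T"
  using assms by (auto simp: continuous_on_iff)

text \<open>The preimage of a ball is a ball of the same radius, and the Lebesgue measure of a ball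
  depends only on its radius, so the two measures agree by the ball criterion with
  \<open>K = UNIV\<close>.\<close>

lemma distr_lborel_isometric_involution:
  fixes T :: "'a::euclidean_space \<Rightarrow> 'a"
  assumes inv: "\<And>x. T (T x) = x" and iso: "\<And>x y. dist (T x) (T y) = dist x y"
  shows "distr lborel borel T = lborel"
proof (rule measure_eqI_balls[where K=UNIV])
  define a where "a e = emeasure lborel (ball (0::'a) e)" for e
  have T [measurable]: "T \<in> borel_measurable borel"
    by (intro borel_measurable_continuous_onI continuous_on_isometric iso)
  have distr: "emeasure (distr lborel borel T) (ball x e) = emeasure lborel (ball (T x) e)" for x e
    by (simp add: emeasure_distr vimage_ball_isometric_involution[OF inv iso])
  have ball: "emeasure lborel (ball x e) = a e" for x :: 'a and e
    by (cases "e \<ge> 0") (auto simp: a_def emeasure_ball ball_empty)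
  show "emeasure lborel (ball x e) = a e" "emeasure (distr lborel borel T) (ball x e) = a e" for x e
    by (simp_all add: distr ball)
  show "emeasure lborel (ball x e) < \<infinity>" "emeasure (distr lborel borel T) (ball x e) < \<infinity>" for x :: 'a and e
    by (cases "e \<ge> 0"; simp add: distr emeasure_ball ball_empty)+
  show "0 < a e \<and> a e < \<infinity>" if "e > 0" for e
    using that by (simp add: a_def emeasure_ball)
qed auto

section \<open>Hausdorff measure\<close>

lemma hausdorff_outer_mono: "A \<subseteq> B \<Longrightarrow> hausdorff_outer k A \<le> hausdorff_outer k B"
  unfolding hausdorff_outer_def by (intro SUP_mono) (use hausdorff_pre_mono in blast)

lemma hausdorff_outer_empty [simp]: "hausdorff_outer k {} = 0"
  by (simp add: hausdorff_outer_def hausdorff_pre_empty)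

lemma hausdorff_outer_subadditive:
  "hausdorff_outer k (\<Union>i::nat. A i) \<le> (\<Sum>i. hausdorff_outer k (A i))"
  unfolding hausdorff_outer_def[of k "\<Union>i. A i"]
proof (rule SUP_least)
  fix d :: real assume d: "d \<in> {0<..}"
  have "hausdorff_pre k d (\<Union>i. A i) \<le> (\<Sum>i. hausdorff_pre k d (A i))"
    by (rule hausdorff_pre_subadditive)
  also have "\<dots> \<le> (\<Sum>i. hausdorff_outer k (A i))"
    unfolding hausdorff_outer_def using d by (intro suminf_le SUP_upper) auto
  finally show "hausdorff_pre k d (\<Union>i. A i) \<le> (\<Sum>i. hausdorff_outer k (A i))" .
qed

lemma hausdorff_outer_Un_le:
  "hausdorff_outer k (A \<union> B) \<le> hausdorff_outer k A + hausdorff_outer k B"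
proof -
  have "(\<Union>i. binaryset A B i) = A \<union> B"
    by (auto simp: UN_binaryset_eq)
  then have "hausdorff_outer k (A \<union> B) \<le> (\<Sum>i. hausdorff_outer k (binaryset A B i))"
    using hausdorff_outer_subadditive[of k "binaryset A B"] by simp
  also have "\<dots> = hausdorff_outer k A + hausdorff_outer k B"
    by (rule suminf_binaryset_eq) simp
  finally show ?thesis .
qed

section \<open>Additivity on separated sets and measurability of Borel sets\<close>

lemma hausdorff_pre_antimono: "d \<le> d' \<Longrightarrow> hausdorff_pre k d' A \<le> hausdorff_pre k d A"
  unfolding hausdorff_pre_def by (rule INF_superset_mono) (auto intro: order_trans)

text \<open>A set of diameter at most \<open>d\<close> cannot meet both \<open>A\<close> and
  \<open>B\<close>, so every admissible cover of the union splits into a cover of \<open>A\<close>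
  and a cover of \<open>B\<close>.\<close>

lemma hausdorff_pre_separated:
  fixes A B :: "'a::metric_space set"
  assumes sep: "\<And>x y. x \<in> A \<Longrightarrow> y \<in> B \<Longrightarrow> d < dist x y"
  shows "hausdorff_pre k d A + hausdorff_pre k d B \<le> hausdorff_pre k d (A \<union> B)"
  unfolding hausdorff_pre_def[of k d "A \<union> B"]
proof (rule INF_greatest)
  fix C :: "nat \<Rightarrow> 'a set"
  assume "C \<in> {C. A \<union> B \<subseteq> (\<Union>i. C i) \<and> (\<forall>i. bounded (C i) \<and> diameter (C i) \<le> d)}"
  then have C: "A \<union> B \<subseteq> (\<Union>i. C i)" "\<And>i. bounded (C i)" "\<And>i. diameter (C i) \<le> d" by auto
  have disj: "C i \<inter> A = {} \<or> C i \<inter> B = {}" for i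
    using sep diameter_bounded_bound[OF C(2)[of i]] C(3)[of i] by (meson disjoint_iff not_le order_trans)
  \<comment> \<open>Sets that miss \<open>X\<close> become empty instead of being dropped, which
    keeps the index set; the empty set has gauge 0.\<close>
  define P where "P X i = (if C i \<inter> X = {} then {} else C i)" for X i
  have "0 \<le> d" using C(2,3) by (meson diameter_ge_0 order_trans)
  have P: "hausdorff_pre k d X \<le> (\<Sum>i. hausdorff_gauge k (P X i))" if X: "X \<subseteq> A \<union> B" for X
    unfolding hausdorff_pre_def
  proof (intro INF_lower CollectI conjI allI)
    show "X \<subseteq> (\<Union>i. P X i)"
    proof
      fix x assume "x \<in> X"
      then obtain i where "x \<in> C i" using C(1) X by blast
      then have "x \<in> P X i" using \<open>x \<in> X\<close> by (auto simp: P_def)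
      then show "x \<in> (\<Union>i. P X i)" by blast
    qed
    show "bounded (P X i)" "diameter (P X i) \<le> d" for i
      using C(2,3)[of i] \<open>0 \<le> d\<close> by (simp_all add: P_def)
  qed
  have "hausdorff_pre k d A + hausdorff_pre k d B
      \<le> (\<Sum>i. hausdorff_gauge k (P A i)) + (\<Sum>i. hausdorff_gauge k (P B i))"
    by (intro add_mono P) auto
  also have "\<dots> = (\<Sum>i. hausdorff_gauge k (P A i) + hausdorff_gauge k (P B i))"
    by (rule suminf_add) auto
  also have "\<dots> \<le> (\<Sum>i. hausdorff_gauge k (C i))"
    using disj by (intro suminf_le) (auto simp: P_def hausdorff_gauge_def)
  finally show "hausdorff_pre k d A + hausdorff_pre k d B \<le> (\<Sum>i. hausdorff_gauge k (C i))" .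
qed

lemma hausdorff_outer_separated:
  fixes A B :: "'a::metric_space set"
  assumes e: "e > 0" and sep: "\<And>x y. x \<in> A \<Longrightarrow> y \<in> B \<Longrightarrow> e \<le> dist x y"
  shows "hausdorff_outer k (A \<union> B) = hausdorff_outer k A + hausdorff_outer k B"
proof (rule antisym[OF hausdorff_outer_Un_le])
  have "hausdorff_outer k A + hausdorff_outer k B
      = (SUP d\<in>{0<..}. hausdorff_pre k d A + hausdorff_pre k d B)"
  proof -
    have "(SUP d\<in>{0::real<..}. hausdorff_pre k d A + hausdorff_pre k d B) =
       (SUP d\<in>{0<..}. hausdorff_pre k d A) + (SUP d\<in>{0<..}. hausdorff_pre k d B)"
    proof (rule SUP_add_directed_ennreal)
      fix i j :: real assume "i \<in> {0<..}" "j \<in> {0<..}"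
      then show "\<exists>d\<in>{0<..}. hausdorff_pre k i A + hausdorff_pre k j B
          \<le> hausdorff_pre k d A + hausdorff_pre k d B"
        by (intro bexI[of _ "min i j"] add_mono hausdorff_pre_antimono) auto
    qed
    then show ?thesis by (simp add: hausdorff_outer_def)
  qed
  also have "\<dots> \<le> hausdorff_outer k (A \<union> B)"
  proof (rule SUP_least)
    fix d :: real assume d: "d \<in> {0<..}"
    \<comment> \<open>Shrinking the scale only increases the premeasure, and below the distance
      \<open>e\<close> covers split.\<close>
    define d' where "d' = min d (e/2)"
    have d': "0 < d'" "d' \<le> d" "d' < e" using d e by (auto simp: d'_def)
    have "hausdorff_pre k d A + hausdorff_pre k d B \<le> hausdorff_pre k d' A + hausdorff_pre k d' B"
      by (intro add_mono hausdorff_pre_antimono d')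
    also have "\<dots> \<le> hausdorff_pre k d' (A \<union> B)"
      using sep d'(3) by (intro hausdorff_pre_separated) (meson less_le_trans)
    also have "\<dots> \<le> hausdorff_outer k (A \<union> B)"
      unfolding hausdorff_outer_def using d'(1) by (intro SUP_upper) auto
    finally show "hausdorff_pre k d A + hausdorff_pre k d B \<le> hausdorff_outer k (A \<union> B)" .
  qed
  finally show "hausdorff_outer k A + hausdorff_outer k B \<le> hausdorff_outer k (A \<union> B)" .
qed

text \<open>Every second shell is skipped, so that the remaining ones have positive distance.\<close>
lemma hausdorff_outer_alternating_shells:
  fixes X :: "'a::metric_space set" and u :: "'a \<Rightarrow> real"
  assumes lip: "\<And>x y. \<bar>u x - u y\<bar> \<le> dist x y"
  defines "R \<equiv> \<lambda>j::nat. {x\<in>X. 1 / Suc (Suc j) \<le> u x \<and> u x < 1 / Suc j}"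
  shows "(\<Sum>j<n. hausdorff_outer k (R (2 * j + i))) \<le> hausdorff_outer k X"
proof -
  have "(\<Sum>j<n. hausdorff_outer k (R (2 * j + i))) \<le> hausdorff_outer k (\<Union>j<n. R (2 * j + i))"
  proof (induction n)
    case (Suc n)
    \<comment> \<open>\<open>a\<close> bounds \<open>u\<close> from above on the new shell, and
      \<open>b\<close> bounds it from below on the earlier ones. For \<open>n = 0\<close> there is
      no earlier shell, and \<open>b\<close> may be \<open>1 / 0 = 0\<close>, hence the case
      distinction.\<close>
    define a b where "a = 1 / real (2 * n + i + 1)" and "b = 1 / real (2 * n + i)"
    have "hausdorff_outer k ((\<Union>j<n. R (2 * j + i)) \<union> R (2 * n + i)) =
        hausdorff_outer k (\<Union>j<n. R (2 * j + i)) + hausdorff_outer k (R (2 * n + i))"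
    proof (cases "n = 0")
      case False
      show ?thesis
      proof (rule hausdorff_outer_separated)
        have "a < b" unfolding a_def b_def using False by (intro divide_strict_left_mono) auto
        then show "0 < b - a" by simp
        fix x y assume "x \<in> (\<Union>j<n. R (2 * j + i))" and y: "y \<in> R (2 * n + i)"
        then obtain j where j: "j < n" "x \<in> R (2 * j + i)" by auto
        have "b \<le> 1 / Suc (Suc (2 * j + i))"
          unfolding b_def using j(1) by (intro divide_left_mono) auto
        then have "b \<le> u x" using j(2) by (auto simp: R_def)
        moreover have "u y < a" using y by (simp add: R_def a_def add.commute)
        ultimately show "b - a \<le> dist x y" using lip[of x y] by linarith
      qed
    qed simp
    then show ?case using Suc by (simp add: lessThan_Suc Un_commute add.commute add_mono)
  qed simp
  also have "\<dots> \<le> hausdorff_outer k X" by (rule hausdorff_outer_mono) (auto simp: R_def)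
  finally show ?thesis .
qed

text \<open>Caratheodory's criterion for metric outer measures. The part with
  \<open>u x \<le> 0\<close> has positive distance from the part \<open>W n\<close> with
  \<open>1 / Suc n \<le> u x\<close>, so the outer measure is additive on these two. The rest lies
  in shells whose outer measures have a convergent sum, so its contribution vanishes as
  \<open>n\<close> grows.\<close>

lemma hausdorff_outer_split_positive:
  fixes X :: "'a::metric_space set" and u :: "'a \<Rightarrow> real"
  assumes lip: "\<And>x y. \<bar>u x - u y\<bar> \<le> dist x y"
  shows "hausdorff_outer k (X \<inter> {x. u x \<le> 0}) + hausdorff_outer k (X \<inter> {x. 0 < u x}) \<le> hausdorff_outer k X"
proof (cases "hausdorff_outer k X = \<infinity>")
  case False
  define R where "R j = {x\<in>X. 1 / Suc (Suc j) \<le> u x \<and> u x < 1 / Suc j}" for j :: nat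
  define W where "W n = {x\<in>X. 1 / Suc n \<le> u x}" for n :: nat
  let ?H = "hausdorff_outer k"
  define s where "s j = enn2real (?H (R j))" for j
  have fin: "?H (R j) \<noteq> \<infinity>" for j
    using hausdorff_outer_mono[of "R j" X k] False by (auto simp: R_def top_unique)
  have s: "ennreal (s j) = ?H (R j)" "0 \<le> s j" for j
    using fin[of j] by (auto simp: s_def less_top)
  have alt: "(\<Sum>j<n. s (2 * j + i)) \<le> enn2real (?H X)" for n i
  proof -
    have "ennreal (\<Sum>j<n. s (2 * j + i)) = (\<Sum>j<n. ?H (R (2 * j + i)))"
      by (simp add: s sum_ennreal flip: s(1))
    also have "\<dots> \<le> ?H X" unfolding R_def by (rule hausdorff_outer_alternating_shells[OF lip])
    finally have "enn2real (ennreal (\<Sum>j<n. s (2 * j + i))) \<le> enn2real (?H X)"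
      using False by (intro enn2real_mono) (auto simp: less_top)
    then show ?thesis by (simp add: s sum_nonneg)
  qed
  \<comment> \<open>The shells of even index and those of odd index are each bounded by the measure
    of \<open>X\<close>.\<close>
  have "summable s"
  proof (rule bounded_imp_summable)
    fix n
    have "(\<Sum>j\<le>n. s j) \<le> (\<Sum>j<2 * Suc n. s j)" by (intro sum_mono2) (auto simp: s)
    also have "\<dots> = (\<Sum>j<Suc n. s (2 * j + 0)) + (\<Sum>j<Suc n. s (2 * j + 1))"
      by (induction n) (auto simp: algebra_simps)
    also have "\<dots> \<le> enn2real (?H X) + enn2real (?H X)" by (intro add_mono alt)
    finally show "(\<Sum>j\<le>n. s j) \<le> enn2real (?H X) + enn2real (?H X)" .
  qed (use s in auto)
  then have tail: "(\<lambda>n. \<Sum>j. s (j + n)) \<longlonglongrightarrow> 0" by (rule suminf_exist_split2)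
  have "?H (X \<inter> {x. u x \<le> 0}) + ?H (X \<inter> {x. 0 < u x}) \<le> ?H X + ennreal (\<Sum>j. s (j + n))" for n
  proof -
    have "X \<inter> {x. 0 < u x} \<subseteq> W n \<union> (\<Union>j. R (j + n))"
    proof
      fix x assume x: "x \<in> X \<inter> {x. 0 < u x}"
      show "x \<in> W n \<union> (\<Union>j. R (j + n))"
      proof (cases "1 / Suc n \<le> u x")
        case False
        obtain q where q: "1 / Suc q \<le> u x" using x
          by (metis IntE mem_Collect_eq nat_approx_posE less_imp_le)
        \<comment> \<open>Minimality of \<open>m\<close> gives the upper bound of the shell with
          index \<open>m - 1\<close>; since \<open>n < m\<close>, this index has the form
          \<open>p + n\<close>.\<close>
        define m where "m = (LEAST m. 1 / Suc m \<le> u x)"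
        have m: "1 / Suc m \<le> u x" unfolding m_def using q by (rule LeastI)
        have "n < m"
        proof (rule ccontr)
          assume "\<not> n < m"
          then have "1 / Suc n \<le> 1 / Suc m" by (simp add: frac_le)
          then show False using m \<open>\<not> 1 / Suc n \<le> u x\<close> by linarith
        qed
        then obtain p where p: "m = Suc (p + n)" by (metis add.commute less_iff_Suc_add)
        have "\<not> 1 / Suc (p + n) \<le> u x" using not_less_Least[of "p + n" "\<lambda>m. 1 / Suc m \<le> u x"] p
          by (simp add: m_def)
        then have "x \<in> R (p + n)" using x m p by (auto simp: R_def)
        then show ?thesis by blast
      qed (use x in \<open>auto simp: W_def\<close>)
    qed
    then have "?H (X \<inter> {x. 0 < u x}) \<le> ?H (W n \<union> (\<Union>j. R (j + n)))" by (rule hausdorff_outer_mono)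
    also have "\<dots> \<le> ?H (W n) + ?H (\<Union>j. R (j + n))" by (rule hausdorff_outer_Un_le)
    also have "\<dots> \<le> ?H (W n) + (\<Sum>j. ?H (R (j + n)))"
      by (intro add_left_mono hausdorff_outer_subadditive)
    also have "(\<Sum>j. ?H (R (j + n))) = ennreal (\<Sum>j. s (j + n))"
      unfolding s(1)[symmetric]
      using \<open>summable s\<close> s(2) by (intro suminf_ennreal2) (auto simp: summable_iff_shift)
    finally have pos: "?H (X \<inter> {x. 0 < u x}) \<le> ?H (W n) + ennreal (\<Sum>j. s (j + n))" .
    have "?H (X \<inter> {x. u x \<le> 0}) + ?H (W n) = ?H (X \<inter> {x. u x \<le> 0} \<union> W n)"
    proof (rule hausdorff_outer_separated[symmetric])
      show "0 < 1 / real (Suc n)" by simp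
      fix x y assume "x \<in> X \<inter> {x. u x \<le> 0}" "y \<in> W n"
      then show "1 / real (Suc n) \<le> dist x y" using lip[of x y] by (auto simp: W_def)
    qed
    also have "\<dots> \<le> ?H X" by (rule hausdorff_outer_mono) (auto simp: W_def)
    finally have le: "?H (X \<inter> {x. u x \<le> 0}) + ?H (W n) \<le> ?H X" .
    show ?thesis
      using order_trans[OF add_left_mono[OF pos] add_right_mono[OF le, folded add.assoc[symmetric]]]
      by (simp add: add.assoc)
  qed
  moreover have "(\<lambda>n. ?H X + ennreal (\<Sum>j. s (j + n))) \<longlonglongrightarrow> ?H X"
    using tendsto_add[OF tendsto_const[of "?H X"] tendsto_ennrealI[OF tail]] by simp
  ultimately show ?thesis by (blast intro: LIMSEQ_le_const)
qed simp

text \<open>The distance to a nonempty closed set \<open>C\<close> is 1-Lipschitz and vanishes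
  exactly on \<open>C\<close>, so splitting along it is Caratheodory's condition for
  \<open>C\<close>.\<close>

lemma sets_hausdorff_measure_borel: "sets borel \<subseteq> sets (hausdorff_measure k :: 'a::metric_space measure)"
proof -
  have "closed C \<Longrightarrow> C \<in> sets (hausdorff_measure k :: 'a measure)" for C
  proof (cases "C = {}")
    case False
    assume "closed C"
    then have iff: "infdist x C \<le> 0 \<longleftrightarrow> x \<in> C" "0 < infdist x C \<longleftrightarrow> x \<notin> C" for x
      using False infdist_nonneg[of x C] by (auto simp: in_closed_iff_infdist_zero)
    have split: "X \<inter> {x. infdist x C \<le> 0} = C \<inter> X"
        "X \<inter> {x. 0 < infdist x C} = (UNIV - C) \<inter> X" for X
      unfolding iff by auto
    have lip: "\<bar>infdist x C - infdist y C\<bar> \<le> dist x y" for x y :: 'a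
      using infdist_triangle[of x C y] infdist_triangle[of y C x] by (auto simp: dist_commute)
    have "hausdorff_outer k (C \<inter> X) + hausdorff_outer k ((UNIV - C) \<inter> X) = hausdorff_outer k X" for X
    proof (rule antisym)
      show "hausdorff_outer k (C \<inter> X) + hausdorff_outer k ((UNIV - C) \<inter> X) \<le> hausdorff_outer k X"
        using hausdorff_outer_split_positive[OF lip, of k X] unfolding split .
      have "X = (C \<inter> X) \<union> ((UNIV - C) \<inter> X)" by auto
      then show "hausdorff_outer k X \<le> hausdorff_outer k (C \<inter> X) + hausdorff_outer k ((UNIV - C) \<inter> X)"
        using hausdorff_outer_Un_le by metis
    qed
    then show ?thesis by (simp add: sets_hausdorff_measure lambda_system_def)
  qed simp
  then have "sigma_sets UNIV (Collect closed) \<subseteq> sets (hausdorff_measure k :: 'a measure)"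
    using sets.sigma_sets_subset[of "Collect closed" "hausdorff_measure k :: 'a measure"] by auto
  then show ?thesis by (simp add: borel_eq_closed)
qed

lemma hausdorff_outer_isometric_involution:
  fixes T :: "'a::metric_space \<Rightarrow> 'a"
  assumes inv: "\<And>x. T (T x) = x" and iso: "\<And>x y. dist (T x) (T y) = dist x y"
  shows "hausdorff_outer k (T ` A) = hausdorff_outer k A"
proof -
  have bd: "bounded (T ` C)" if "bounded C" for C
  proof -
    obtain x e where "\<And>y. y \<in> C \<Longrightarrow> dist x y \<le> e" using \<open>bounded C\<close> by (auto simp: bounded_def)
    then have "\<forall>y\<in>T ` C. dist (T x) y \<le> e" by (auto simp: iso)
    then show ?thesis unfolding bounded_def by blast
  qed
  have dia: "diameter (T ` C) = diameter C" for C
  proof -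
    have "(T ` C) \<times> (T ` C) = (\<lambda>(x, y). (T x, T y)) ` (C \<times> C)" by auto
    then show ?thesis by (simp add: diameter_def image_image case_prod_beta iso)
  qed
  have "hausdorff_pre k d (T ` A) \<le> hausdorff_pre k d A" for d A
    unfolding hausdorff_pre_def[of k d A]
  proof (rule INF_greatest)
    fix C :: "nat \<Rightarrow> 'a set"
    assume "C \<in> {C. A \<subseteq> (\<Union>i. C i) \<and> (\<forall>i. bounded (C i) \<and> diameter (C i) \<le> d)}"
    then have C: "T ` A \<subseteq> (\<Union>i. T ` C i)" "\<And>i. bounded (C i)" "\<And>i. diameter (C i) \<le> d"
      by blast+
    have "hausdorff_pre k d (T ` A) \<le> (\<Sum>i. hausdorff_gauge k (T ` C i))"
      unfolding hausdorff_pre_def using C by (intro INF_lower CollectI conjI allI) (simp_all add: bd dia)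
    moreover have "hausdorff_gauge k (T ` C i) = hausdorff_gauge k (C i)" for i
      by (simp add: hausdorff_gauge_def dia)
    ultimately show "hausdorff_pre k d (T ` A) \<le> (\<Sum>i. hausdorff_gauge k (C i))" by simp
  qed
  then have *: "hausdorff_outer k (T ` A) \<le> hausdorff_outer k A" for A
    unfolding hausdorff_outer_def by (intro SUP_mono) blast
  have "T ` T ` A = A" by (force simp: image_image inv)
  then show ?thesis using *[of A] *[of "T ` A"] by auto
qed

section \<open>The measure of the sphere\<close>

text \<open>The finite cover is enumerated and continued by empty sets of gauge 0.\<close>

lemma hausdorff_pre_finite_cover_le:
  assumes C: "finite C" "A \<subseteq> (\<Union>x\<in>C. D x)" and D: "\<And>x. x \<in> C \<Longrightarrow> bounded (D x) \<and> diameter (D x) \<le> d"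
    and d: "0 \<le> d"
  shows "hausdorff_pre k d A \<le> (\<Sum>x\<in>C. hausdorff_gauge k (D x))"
proof -
  obtain h where h: "bij_betw h {0..<card C} C" using ex_bij_betw_nat_finite[OF C(1)] by blast
  define E where "E i = (if i < card C then D (h i) else {})" for i
  have hC: "h i \<in> C" if "i < card C" for i using h that by (auto simp: bij_betw_def)
  have "hausdorff_pre k d A \<le> (\<Sum>i. hausdorff_gauge k (E i))"
    unfolding hausdorff_pre_def
  proof (intro INF_lower CollectI conjI allI)
    show "A \<subseteq> (\<Union>i. E i)"
    proof
      fix a assume "a \<in> A"
      then obtain x where x: "x \<in> C" "a \<in> D x" using C(2) by blast
      then obtain i where "i < card C" "h i = x"
        using h unfolding bij_betw_def by (metis atLeastLessThan_iff imageE)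
      then have "a \<in> E i" using x by (simp add: E_def)
      then show "a \<in> (\<Union>i. E i)" by blast
    qed
    show "bounded (E i)" "diameter (E i) \<le> d" for i using D[OF hC, of i] d by (simp_all add: E_def)
  qed
  also have "\<dots> = (\<Sum>i\<in>{0..<card C}. hausdorff_gauge k (E i))"
    by (rule suminf_finite) (auto simp: E_def hausdorff_gauge_def)
  also have "\<dots> = (\<Sum>i\<in>{0..<card C}. hausdorff_gauge k (D (h i)))"
    by (rule sum.cong) (auto simp: E_def)
  also have "\<dots> = (\<Sum>x\<in>C. hausdorff_gauge k (D x))"
    by (rule sum.reindex_bij_betw[OF h])
  finally show ?thesis .
qed

text \<open>The mean value estimate for powers, used to bound the volume of a thin spherical
  shell.\<close>

lemma power_diff_le:
  fixes a b :: real
  assumes "0 \<le> b" "b \<le> a"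
  shows "a ^ Suc k - b ^ Suc k \<le> real (Suc k) * (a - b) * a ^ k"
proof (induction k)
  case (Suc k)
  have "a ^ Suc (Suc k) - b ^ Suc (Suc k) = a * (a ^ Suc k - b ^ Suc k) + (a - b) * b ^ Suc k"
    by (simp add: algebra_simps)
  also have "\<dots> \<le> a * (real (Suc k) * (a - b) * a ^ k) + (a - b) * a ^ Suc k"
    using assms Suc.IH by (intro add_mono mult_left_mono power_mono) auto
  also have "\<dots> = real (Suc (Suc k)) * (a - b) * a ^ Suc k" by (simp add: algebra_simps)
  finally show ?case .
qed simp

text \<open>The balls fit into the shell of width \<open>2 * e\<close> around the sphere.\<close>
lemma card_disjoint_balls_on_sphere_le:
  fixes c :: "'a::euclidean_space"
  assumes DIM: "DIM('a) = Suc k" and e: "0 < e" "e \<le> r"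
    and F: "finite F" "F \<subseteq> sphere c r" "disjoint_family_on (\<lambda>x. cball x e) F"
  shows "real (card F) * e ^ k \<le> real (Suc k) * 2 * (2 * r) ^ k"
proof -
  define w where "w = unit_ball_vol (real (Suc k))"
  have w: "w > 0" by (simp add: w_def)
  have "real (card F) * (w * e ^ Suc k) = (\<Sum>x\<in>F. measure lebesgue (cball x e))"
    using e by (simp add: content_cball DIM w_def)
  also have "\<dots> = measure lebesgue (\<Union>x\<in>F. cball x e)"
    by (rule measure_finite_Union[symmetric]) (use F in \<open>auto simp: emeasure_cball less_top[symmetric] e less_imp_le\<close>)
  also have "\<dots> \<le> measure lebesgue (cball c (r + e) - ball c (r - e))"
  proof (rule measure_mono_fmeasurable)
    show "(\<Union>x\<in>F. cball x e) \<subseteq> cball c (r + e) - ball c (r - e)"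
    proof (intro UN_least subsetI)
      fix x y assume "x \<in> F" "y \<in> cball x e"
      then have "dist c x = r" "dist x y \<le> e" using F(2) by auto
      then show "y \<in> cball c (r + e) - ball c (r - e)"
        using dist_triangle[of c y x] dist_triangle[of c x y] by (auto simp: dist_commute)
    qed
    show "cball c (r + e) - ball c (r - e) \<in> lmeasurable" by (intro fmeasurable.Diff) auto
  qed (use F in auto)
  also have "\<dots> = measure lebesgue (cball c (r + e)) - measure lebesgue (ball c (r - e))"
    using e by (intro measurable_measure_Diff) auto
  also have "\<dots> = w * ((r + e) ^ Suc k - (r - e) ^ Suc k)"
    using e by (simp add: content_cball content_ball DIM w_def algebra_simps)
  also have "\<dots> \<le> w * (real (Suc k) * (2 * e) * (2 * r) ^ k)"
  proof -
    have "(r + e) ^ Suc k - (r - e) ^ Suc k \<le> real (Suc k) * ((r + e) - (r - e)) * (r + e) ^ k"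
      using e by (intro power_diff_le) auto
    also have "\<dots> \<le> real (Suc k) * ((r + e) - (r - e)) * (2 * r) ^ k"
      using e by (intro mult_left_mono power_mono) auto
    finally show ?thesis using w by (intro mult_left_mono) auto
  qed
  finally have "w * e * (real (card F) * e ^ k) \<le> w * e * (real (Suc k) * 2 * (2 * r) ^ k)"
    by (simp add: algebra_simps)
  then show ?thesis using w e by simp
qed

text \<open>Vitali's lemma selects disjoint balls of radius \<open>e\<close> centred on the sphere
  whose fivefold enlargements cover it. Their number is at most a constant over
  \<open>e ^ k\<close>, while each enlargement has gauge proportional to \<open>e ^ k\<close>, so
  the bound does not depend on \<open>e\<close>.\<close>

lemma hausdorff_outer_sphere_finite:
  fixes c :: "'a::euclidean_space"
  assumes DIM: "DIM('a) = Suc k" and r: "r > 0"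
  shows "hausdorff_outer k (sphere c r) < \<infinity>"
proof -
  define Q where "Q = real (Suc k) * 2 * (2 * r) ^ k"
  define B where "B = unit_ball_vol (real k) * 5 ^ k * Q"
  \<comment> \<open>\<open>10 * e\<close> is the diameter of the enlarged balls of radius
    \<open>5 * e\<close>.\<close>
  have main: "hausdorff_pre k (10 * e) (sphere c r) \<le> ennreal B" if e: "0 < e" "e \<le> r" for e
  proof -
    have cover: "sphere c r \<subseteq> (\<Union>x\<in>sphere c r. cball x e)" using e by auto
    obtain C where C: "C \<subseteq> sphere c r"
        "pairwise (\<lambda>x y. disjnt (cball x e) (cball y e)) C"
        "sphere c r \<subseteq> (\<Union>x\<in>C. cball x (5 * e))"
      by (rule Vitali_covering_lemma_cballs[OF cover, of e]) (use e in simp, blast)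
    have bound: "real (card F) * e ^ k \<le> Q" if "finite F" "F \<subseteq> C" for F
      unfolding Q_def
    proof (rule card_disjoint_balls_on_sphere_le[OF DIM e that(1)])
      show "disjoint_family_on (\<lambda>x. cball x e) F"
        using C(2) that(2) unfolding disjoint_family_on_def pairwise_def disjnt_def by blast
    qed (use C that in auto)
    have "finite C"
    proof (rule ccontr)
      assume "infinite C"
      then obtain F where F: "finite F" "card F = Suc (nat \<lceil>Q / e ^ k\<rceil>)" "F \<subseteq> C"
        using infinite_arbitrarily_large by metis
      have "Q / e ^ k < real (card F)" unfolding F(2) by linarith
      then show False using bound[OF F(1,3)] e by (simp add: field_simps)
    qed
    then have "hausdorff_pre k (10 * e) (sphere c r) \<le> (\<Sum>x\<in>C. hausdorff_gauge k (cball x (5 * e)))"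
      using e by (intro hausdorff_pre_finite_cover_le C) auto
    also have "\<dots> = ennreal (real (card C) * (unit_ball_vol (real k) * (5 * e) ^ k))"
      using e by (simp add: hausdorff_gauge_def ennreal_of_nat_eq_real_of_nat flip: ennreal_mult)
    also have "\<dots> = ennreal (unit_ball_vol (real k) * 5 ^ k * (real (card C) * e ^ k))"
      by (simp add: power_mult_distrib mult_ac)
    also have "\<dots> \<le> ennreal B"
      unfolding B_def using bound[OF \<open>finite C\<close>] by (intro ennreal_leI mult_left_mono) auto
    finally show ?thesis .
  qed
  have "hausdorff_outer k (sphere c r) \<le> ennreal B"
    unfolding hausdorff_outer_def
  proof (rule SUP_least)
    fix d :: real assume "d \<in> {0<..}"
    \<comment> \<open>The minimum with \<open>r\<close> keeps the scale in the range where the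
      packing bound holds.\<close>
    then have "hausdorff_pre k d (sphere c r) \<le> hausdorff_pre k (10 * min r (d / 10)) (sphere c r)"
      by (intro hausdorff_pre_antimono) auto
    also have "\<dots> \<le> ennreal B" using \<open>d \<in> {0<..}\<close> r by (intro main) auto
    finally show "hausdorff_pre k d (sphere c r) \<le> ennreal B" .
  qed
  then show ?thesis by (simp add: le_less_trans)
qed

section \<open>Radial projection and the cone measure\<close>

definition radial :: "'a::real_normed_vector \<Rightarrow> real \<Rightarrow> 'a \<Rightarrow> 'a" where
  "radial c r y = c + (r / norm (y - c)) *\<^sub>R (y - c)"

text \<open>A subset of the sphere receives the volume of the cone over it with apex
  \<open>c\<close>. The total mass is the volume of the ball, without normalisation.\<close>

definition cone_measure :: "'a::euclidean_space \<Rightarrow> real \<Rightarrow> 'a measure" where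
  "cone_measure c r = distr (restrict_space lborel (ball c r)) borel (radial c r)"

lemma measurable_radial [measurable]: "radial c r \<in> borel_measurable (borel :: 'a::euclidean_space measure)"
  unfolding radial_def[abs_def] by measurable

lemma radial_in_sphere: "r > 0 \<Longrightarrow> y \<noteq> c \<Longrightarrow> radial c r y \<in> sphere c r"
  by (simp add: radial_def dist_norm)

lemma radial_polar:
  assumes "r > 0"
  shows "y = c + (norm (y - c) / r) *\<^sub>R (radial c r y - c)"
  using assms by (simp add: radial_def)

lemma sets_cone_measure [simp, measurable_cong]: "sets (cone_measure c r) = sets borel"
  by (simp add: cone_measure_def)

lemma space_cone_measure [simp]: "space (cone_measure c r) = UNIV"
  by (simp add: cone_measure_def)

lemma emeasure_cone_measure:
  fixes c :: "'a::euclidean_space"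
  assumes A: "A \<in> sets borel"
  shows "emeasure (cone_measure c r) A = emeasure lborel (ball c r \<inter> radial c r -` A)"
proof -
  have "radial c r -` A \<in> sets borel" using measurable_sets[OF measurable_radial A, of c r] by simp
  moreover have "radial c r \<in> restrict_space lborel (ball c r) \<rightarrow>\<^sub>M borel"
    by (rule measurable_restrict_space1) simp
  ultimately show ?thesis using A unfolding cone_measure_def
    by (subst emeasure_distr) (auto simp: emeasure_restrict_space space_restrict_space Int_commute intro!: arg_cong[where f="emeasure lborel"])
qed

lemma nn_integral_cone_measure:
  fixes c :: "'a::euclidean_space"
  assumes [measurable]: "f \<in> borel_measurable borel"
  shows "(\<integral>\<^sup>+x. f x \<partial>cone_measure c r) = (\<integral>\<^sup>+y. f (radial c r y) * indicator (ball c r) y \<partial>lborel)"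
proof -
  have "radial c r \<in> restrict_space lborel (ball c r) \<rightarrow>\<^sub>M borel"
    by (rule measurable_restrict_space1) simp
  then show ?thesis unfolding cone_measure_def
    by (subst nn_integral_distr) (auto simp: nn_integral_restrict_space)
qed

lemma emeasure_cone_measure_UNIV:
  fixes c :: "'a::euclidean_space"
  shows "emeasure (cone_measure c r) UNIV = emeasure lborel (ball c r)"
  by (simp add: emeasure_cone_measure)

lemma AE_cone_measure_sphere:
  fixes c :: "'a::euclidean_space"
  assumes r: "r > 0"
  shows "AE x in cone_measure c r. x \<in> sphere c r"
proof -
  have "radial c r \<in> restrict_space lborel (ball c r) \<rightarrow>\<^sub>M borel"
    by (rule measurable_restrict_space1) simp
  moreover have "AE y in lborel. y \<noteq> c" by (rule AE_lborel_singleton)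
  then have "AE y in restrict_space lborel (ball c r). radial c r y \<in> sphere c r"
    by (subst AE_restrict_space_iff) (auto simp del: mem_sphere intro: radial_in_sphere[OF r])
  ultimately show ?thesis unfolding cone_measure_def
    by (subst AE_distr_iff) (auto simp: borel_closed)
qed

text \<open>The reflection exchanging \<open>x\<close> and \<open>y\<close> fixes \<open>c\<close>,
  preserves Lebesgue measure and the ball, and commutes with radial projection.\<close>

lemma cone_measure_ball_unif:
  fixes c :: "'a::euclidean_space"
  assumes "x \<in> sphere c r" "y \<in> sphere c r"
  shows "emeasure (cone_measure c r) (ball x e) = emeasure (cone_measure c r) (ball y e)"
proof -
  define T where "T = reflect_through (x - y) c"
  have n: "norm (x - c) = norm (y - c)"
    using assms by (simp add: dist_norm norm_minus_commute)
  have T: "T (T z) = z" "dist (T u) (T v) = dist u v" "T c = c" "T x = y" for u v z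
    unfolding T_def by (simp, simp, simp add: reflect_through_def) (rule reflect_through_swap[OF n])
  have [measurable]: "T \<in> borel_measurable borel"
    by (intro borel_measurable_continuous_onI continuous_on_isometric T)
  have rad: "radial c r (T z) = T (radial c r z)" for z
    using T(2)[of z c] T(3) by (simp add: radial_def T_def reflect_through_affine dist_norm)
  have "emeasure (cone_measure c r) (ball x e) = emeasure (distr lborel borel T) (ball c r \<inter> radial c r -` ball x e)"
    by (simp add: emeasure_cone_measure distr_lborel_isometric_involution[OF T(1,2)])
  also have "\<dots> = emeasure lborel (T -` (ball c r \<inter> radial c r -` ball x e))"
    using measurable_sets[OF measurable_radial, of "ball x e" c r] by (subst emeasure_distr) auto
  also have "T -` (ball c r \<inter> radial c r -` ball x e) = ball c r \<inter> radial c r -` ball y e"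
  proof -
    have "dist c (T z) = dist c z" "dist x (T z) = dist y z" for z
      using T(2)[of c z] T(3) T(2)[of y z] T(1)[of x] T(4) by simp_all
    then show ?thesis by (auto simp: rad)
  qed
  also have "emeasure lborel \<dots> = emeasure (cone_measure c r) (ball y e)"
    by (simp add: emeasure_cone_measure)
  finally show ?thesis .
qed

text \<open>
  The cone over the cap is covered by about \<open>r / d\<close> balls of radius \<open>2 * d\<close> centred on the radius
  through \<open>x\<close>.
\<close>
lemma emeasure_cone_measure_cball_le:
  fixes c :: "'a::euclidean_space"
  assumes DIM: "DIM('a) = Suc k" and d: "0 < d" "d \<le> r" and x: "x \<in> sphere c r"
  shows "emeasure (cone_measure c r) (cball x d)
    \<le> ennreal (3 * r * 2 ^ Suc k * unit_ball_vol (real (Suc k)) * d ^ k)"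
proof -
  have r: "r > 0" using d by simp
  \<comment> \<open>The radius is cut into \<open>m\<close> pieces of length at most
    \<open>d\<close>; with \<open>d \<le> r\<close> the number \<open>m + 1\<close> of division
    points is at most \<open>3 * r / d\<close>.\<close>
  define m where "m = nat \<lceil>r / d\<rceil>"
  have "1 \<le> r / d" using d by simp
  then have m: "1 \<le> real m" "r / d \<le> real m" "real m \<le> r / d + 1" unfolding m_def by linarith+
  have rm: "r / real m \<le> d" using m d by (simp add: field_simps)
  define p where "p j = c + (real j / real m) *\<^sub>R (x - c)" for j
  have "ball c r \<inter> radial c r -` cball x d \<subseteq> (\<Union>j\<in>{..m}. cball (p j) (2 * d))"
  proof
    fix y assume "y \<in> ball c r \<inter> radial c r -` cball x d"
    then have y: "norm (y - c) < r" "norm (radial c r y - x) \<le> d"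
      by (auto simp: dist_norm norm_minus_commute)
    define t where "t = norm (y - c) / r"
    have t: "0 \<le> t" "t \<le> 1" using y r by (auto simp: t_def)
    define j where "j = nat \<lfloor>t * real m\<rfloor>"
    have "0 \<le> t * real m" "t * real m \<le> real m" using t m(1) by (auto simp: mult_left_le_one_le)
    then have j: "real j \<le> t * real m" "t * real m \<le> real j + 1" "j \<le> m" unfolding j_def by linarith+
    have tj: "\<bar>t - real j / real m\<bar> \<le> 1 / real m"
    proof -
      have "t - real j / real m = (t * real m - real j) / real m" using m(1) by (simp add: field_simps)
      moreover have "\<bar>t * real m - real j\<bar> \<le> 1" using j by simp
      ultimately show ?thesis using m(1) by (simp add: abs_divide divide_right_mono)
    qed
    \<comment> \<open>The displacement splits into one between the rays, at most \<open>d\<close>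
      since \<open>t \<le> 1\<close>, and one along the ray through \<open>x\<close>, at most
      \<open>r / real m \<le> d\<close>.\<close>
    have "y - p j = t *\<^sub>R (radial c r y - x) + (t - real j / real m) *\<^sub>R (x - c)"
      using radial_polar[OF r, of y c] by (simp add: p_def t_def algebra_simps)
    then have "norm (y - p j) \<le> t * norm (radial c r y - x) + \<bar>t - real j / real m\<bar> * norm (x - c)"
      using norm_triangle_ineq[of "t *\<^sub>R (radial c r y - x)" "(t - real j / real m) *\<^sub>R (x - c)"] t
      by simp
    also have "\<dots> \<le> 1 * d + (1 / real m) * r"
      using t y tj x r by (intro add_mono mult_mono) (auto simp: dist_norm norm_minus_commute)
    also have "\<dots> \<le> 2 * d" using rm by simp
    finally have "y \<in> cball (p j) (2 * d)" by (simp add: dist_norm norm_minus_commute)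
    then show "y \<in> (\<Union>j\<in>{..m}. cball (p j) (2 * d))" using j(3) by blast
  qed
  then have "emeasure (cone_measure c r) (cball x d) \<le> emeasure lborel (\<Union>j\<in>{..m}. cball (p j) (2 * d))"
    by (simp add: emeasure_cone_measure) (intro emeasure_mono, auto)
  also have "\<dots> \<le> (\<Sum>j\<in>{..m}. emeasure lborel (cball (p j) (2 * d)))"
    by (rule emeasure_subadditive_finite) auto
  also have "\<dots> = ennreal (real (Suc m) * (unit_ball_vol (real (Suc k)) * (2 * d) ^ Suc k))"
    using d by (simp add: emeasure_cball DIM ennreal_of_nat_eq_real_of_nat ennreal_mult
        del: of_nat_Suc power_Suc)
  also have "\<dots> \<le> ennreal (3 * r / d * (unit_ball_vol (real (Suc k)) * (2 * d) ^ Suc k))"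
  proof (intro ennreal_leI mult_right_mono)
    have "real (Suc m) \<le> r / d + 2" using m(3) by simp
    also have "\<dots> \<le> 3 * r / d" using d by (simp add: field_simps)
    finally show "real (Suc m) \<le> 3 * r / d" .
  qed (use d in auto)
  also have "3 * r / d * (unit_ball_vol (real (Suc k)) * (2 * d) ^ Suc k)
      = 3 * r * 2 ^ Suc k * unit_ball_vol (real (Suc k)) * d ^ k"
    using d by (simp add: power_mult_distrib)
  finally show ?thesis .
qed

text \<open>Mass distribution principle: the cone measure of a ball of radius \<open>d\<close>
  centred on the sphere is at most \<open>K * d ^ k\<close>, so the gauges of any fine cover add up
  to at least a fixed fraction of the positive total mass.\<close>

lemma hausdorff_outer_sphere_pos:
  fixes c :: "'a::euclidean_space"
  assumes DIM: "DIM('a) = Suc k" and k: "k \<ge> 1" and r: "r > 0"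
  shows "hausdorff_outer k (sphere c r) > 0"
proof -
  let ?M = "cone_measure c r"
  define K where "K = 3 * r * 2 ^ Suc k * unit_ball_vol (real (Suc k))"
  have K: "K > 0" using r by (simp add: K_def)
  have bound: "emeasure ?M (cball x d) \<le> ennreal (K * d ^ k)" if x: "x \<in> sphere c r" and d: "0 \<le> d" "d \<le> r" for x d
  proof (cases "d = 0")
    \<comment> \<open>Covers may contain single points, of diameter 0; their bound is the limit of
      the bounds for positive radii.\<close>
    case True
    have le: "emeasure ?M (cball x 0) \<le> ennreal (K * (r / Suc n) ^ k)" for n
    proof -
      have "emeasure ?M (cball x 0) \<le> emeasure ?M (cball x (r / Suc n))"
        using r by (intro emeasure_mono) auto
      also have "\<dots> \<le> ennreal (K * (r / Suc n) ^ k)"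
        unfolding K_def using r by (intro emeasure_cone_measure_cball_le[OF DIM _ _ x]) (auto simp: field_simps)
      finally show ?thesis .
    qed
    have "(\<lambda>n. r * inverse (real (Suc n))) \<longlonglongrightarrow> r * 0"
      by (intro tendsto_mult tendsto_const LIMSEQ_inverse_real_of_nat)
    from tendsto_mult[OF tendsto_const[of K] tendsto_power[OF this, of k]]
    have "(\<lambda>n. K * (r / Suc n) ^ k) \<longlonglongrightarrow> K * (r * 0) ^ k"
      by (simp only: divide_inverse)
    then have "(\<lambda>n. ennreal (K * (r / Suc n) ^ k)) \<longlonglongrightarrow> ennreal (K * d ^ k)"
      using True by (intro tendsto_ennrealI) simp
    then have "emeasure ?M (cball x 0) \<le> ennreal (K * d ^ k)"
      by (rule LIMSEQ_le_const) (use le in blast)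
    then show ?thesis by (simp only: True)
  next
    case False
    then show ?thesis unfolding K_def
      using d by (intro emeasure_cone_measure_cball_le[OF DIM _ _ x]) auto
  qed
  \<comment> \<open>Chosen so that \<open>K * d ^ k\<close> is \<open>L\<close> times the gauge of a
    nonempty set of diameter \<open>d\<close>.\<close>
  define L where "L = K * 2 ^ k / unit_ball_vol (real k)"
  have L: "L > 0" using K by (simp add: L_def)
  have "emeasure ?M (sphere c r) \<le> ennreal L * (\<Sum>i. hausdorff_gauge k (C i))"
    if C: "sphere c r \<subseteq> (\<Union>i. C i)" "\<And>i. bounded (C i)" "\<And>i. diameter (C i) \<le> r" for C :: "nat \<Rightarrow> 'a set"
  proof -
    \<comment> \<open>The mass bound needs balls centred on the sphere: each cover set meeting the
      sphere is enlarged to a ball around one of its points there, with its diameter as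
      radius.\<close>
    define N where "N i = (if C i \<inter> sphere c r = {} then {}
      else cball (SOME x. x \<in> C i \<inter> sphere c r) (diameter (C i)))" for i
    have N: "C i \<inter> sphere c r \<subseteq> N i \<and> emeasure ?M (N i) \<le> ennreal L * hausdorff_gauge k (C i)" for i
    proof (cases "C i \<inter> sphere c r = {}")
      case False
      define x where "x = (SOME x. x \<in> C i \<inter> sphere c r)"
      have x: "x \<in> C i \<inter> sphere c r" unfolding x_def using False by (simp only: some_in_eq not_False_eq_True)
      have Ni: "N i = cball x (diameter (C i))" using False by (simp add: N_def x_def)
      have "C i \<subseteq> N i" unfolding Ni using x diameter_bounded_bound[OF C(2)[of i]] by auto
      moreover have "emeasure ?M (N i) \<le> ennreal (K * diameter (C i) ^ k)"
        unfolding Ni using x C(2,3)[of i] by (intro bound) (auto simp: diameter_ge_0)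
      moreover have "ennreal (K * diameter (C i) ^ k) = ennreal L * hausdorff_gauge k (C i)"
      proof -
        have "unit_ball_vol (real k) > 0" by simp
        then have "unit_ball_vol (real k) \<noteq> 0" by linarith
        then have "L * (unit_ball_vol (real k) * (diameter (C i) / 2) ^ k) = K * diameter (C i) ^ k"
          by (simp add: L_def power_divide)
        moreover have "C i \<noteq> {}" using x by auto
        moreover have "0 \<le> diameter (C i)" using C(2) by (simp add: diameter_ge_0)
        ultimately show ?thesis using L by (simp add: hausdorff_gauge_def flip: ennreal_mult)
      qed
      ultimately show ?thesis by auto
    qed (simp add: N_def)
    have "sphere c r \<subseteq> (\<Union>i. N i)"
    proof
      fix x assume x: "x \<in> sphere c r"
      then obtain i where "x \<in> C i" using C(1) by blast
      then have "x \<in> N i" using N[of i] x by blast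
      then show "x \<in> (\<Union>i. N i)" by blast
    qed
    then have "emeasure ?M (sphere c r) \<le> emeasure ?M (\<Union>i. N i)"
      by (rule emeasure_mono) (auto simp: N_def)
    also have "\<dots> \<le> (\<Sum>i. emeasure ?M (N i))"
      by (rule emeasure_subadditive_countably) (auto simp: N_def)
    also have "\<dots> \<le> (\<Sum>i. ennreal L * hausdorff_gauge k (C i))"
      using N by (intro suminf_le) auto
    also have "\<dots> = ennreal L * (\<Sum>i. hausdorff_gauge k (C i))" by simp
    finally show ?thesis .
  qed
  note cover = this
  have "emeasure ?M (sphere c r) / ennreal L \<le> hausdorff_pre k r (sphere c r)"
    unfolding hausdorff_pre_def
  proof (rule INF_greatest)
    fix C :: "nat \<Rightarrow> 'a set"
    assume "C \<in> {C. sphere c r \<subseteq> (\<Union>i. C i) \<and> (\<forall>i. bounded (C i) \<and> diameter (C i) \<le> r)}"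
    then have "emeasure ?M (sphere c r) \<le> ennreal L * (\<Sum>i. hausdorff_gauge k (C i))"
      by (intro cover) blast+
    then show "emeasure ?M (sphere c r) / ennreal L \<le> (\<Sum>i. hausdorff_gauge k (C i))"
      using L by (intro divide_le_posI_ennreal) (auto simp: mult.commute)
  qed
  also have "\<dots> \<le> hausdorff_outer k (sphere c r)"
    unfolding hausdorff_outer_def using r by (intro SUP_upper) auto
  finally have le: "emeasure ?M (sphere c r) / ennreal L \<le> hausdorff_outer k (sphere c r)" .
  have "emeasure ?M (sphere c r) = emeasure ?M UNIV"
    using AE_cone_measure_sphere[OF r, of c] by (intro emeasure_eq_AE) auto
  also have "\<dots> > 0"
    using r by (simp add: emeasure_cone_measure_UNIV emeasure_ball)
  finally have "0 < emeasure ?M (sphere c r) / ennreal L"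
    by (simp add: ennreal_zero_less_divide)
  then show ?thesis using le by (rule less_le_trans)
qed

section \<open>The surface measure of the sphere and its comparison with the cone measure\<close>

text \<open>
  The surface measure as a Borel measure on the whole space; the Hausdorff measure itself lives on the
  larger \<open>\<sigma>\<close>-algebra of Caratheodory-measurable sets.
\<close>
definition sphere_hausdorff :: "nat \<Rightarrow> 'a::euclidean_space \<Rightarrow> real \<Rightarrow> 'a measure" where
  "sphere_hausdorff k c r = distr (restrict_space (hausdorff_measure k) (sphere c r)) borel (\<lambda>x. x)"

lemma borel_measurable_restrict_hausdorff:
  fixes f :: "'a::euclidean_space \<Rightarrow> 'b::topological_space"
  assumes "f \<in> borel_measurable borel"
  shows "f \<in> borel_measurable (restrict_space (hausdorff_measure k) A)"
proof -
  have "f \<in> borel_measurable (hausdorff_measure k)"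
    using measurable_sets[OF assms] sets_hausdorff_measure_borel[of k, where 'a='a]
    by (intro measurableI) auto
  then show ?thesis by (rule measurable_restrict_space1)
qed

lemma sets_sphere_hausdorff [simp, measurable_cong]: "sets (sphere_hausdorff k c r) = sets borel"
  by (simp add: sphere_hausdorff_def)

lemma space_sphere_hausdorff [simp]: "space (sphere_hausdorff k c r) = UNIV"
  by (simp add: sphere_hausdorff_def)

lemma sphere_in_sets_hausdorff: "sphere c r \<in> sets (hausdorff_measure k :: 'a::euclidean_space measure)"
  by (rule subsetD[OF sets_hausdorff_measure_borel borel_closed[OF closed_sphere]])

lemma nn_integral_sphere_hausdorff:
  fixes c :: "'a::euclidean_space"
  assumes "f \<in> borel_measurable borel"
  shows "(\<integral>\<^sup>+x. f x \<partial>sphere_hausdorff k c r)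
    = (\<integral>\<^sup>+x. f x \<partial>restrict_space (hausdorff_measure k) (sphere c r))"
  using assms unfolding sphere_hausdorff_def
  by (subst nn_integral_distr) (auto intro: borel_measurable_restrict_hausdorff)

lemma emeasure_sphere_hausdorff:
  fixes c :: "'a::euclidean_space"
  assumes A: "A \<in> sets borel"
  shows "emeasure (sphere_hausdorff k c r) A = hausdorff_outer k (A \<inter> sphere c r)"
proof -
  have "A \<inter> sphere c r \<in> sets (hausdorff_measure k)"
    using A sets_hausdorff_measure_borel sphere_in_sets_hausdorff by (intro sets.Int) auto
  moreover have "emeasure (sphere_hausdorff k c r) A
      = emeasure (restrict_space (hausdorff_measure k) (sphere c r)) (A \<inter> sphere c r)"
    unfolding sphere_hausdorff_def
    by (subst emeasure_distr[OF borel_measurable_restrict_hausdorff A]) (auto simp: space_restrict_space)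
  ultimately show ?thesis
    by (simp add: emeasure_restrict_space sphere_in_sets_hausdorff emeasure_hausdorff_measure)
qed

lemma AE_sphere_hausdorff: "AE x in sphere_hausdorff k c r. x \<in> sphere c (r::real)"
  unfolding sphere_hausdorff_def
  by (subst AE_distr_iff)
     (auto intro: borel_measurable_restrict_hausdorff simp: space_restrict_space simp del: mem_sphere intro!: AE_I2)

text \<open>The reflection exchanging \<open>x\<close> and \<open>y\<close> maps the sphere to
  itself and preserves Hausdorff outer measure.\<close>

lemma sphere_hausdorff_ball_unif:
  fixes c :: "'a::euclidean_space"
  assumes "x \<in> sphere c r" "y \<in> sphere c r"
  shows "emeasure (sphere_hausdorff k c r) (ball x e) = emeasure (sphere_hausdorff k c r) (ball y e)"
proof -
  define T where "T = reflect_through (x - y) c"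
  have n: "norm (x - c) = norm (y - c)"
    using assms by (simp add: dist_norm norm_minus_commute)
  have T: "T (T z) = z" "dist (T u) (T v) = dist u v" "T c = c" "T x = y" for u v z
    unfolding T_def by (simp, simp, simp add: reflect_through_def) (rule reflect_through_swap[OF n])
  have "T -` (ball y e \<inter> sphere c r) = ball x e \<inter> sphere c r"
  proof -
    have "dist c (T z) = dist c z" "dist y (T z) = dist x z" for z
      using T(2)[of c z] T(3) T(2)[of x z] T(4) by simp_all
    then show ?thesis by auto
  qed
  moreover have "T ` A = T -` A" for A using T(1) by (auto intro: rev_image_eqI) 
  ultimately show ?thesis
    using hausdorff_outer_isometric_involution[OF T(1,2), where A="ball y e \<inter> sphere c r" and k=k]
    by (simp add: emeasure_sphere_hausdorff)
qed

text \<open>Both measures are finite, concentrated on the sphere and uniform there; the factor is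
  chosen to make the total masses equal. It can be formed because the sphere has positive and finite
  Hausdorff measure.\<close>

lemma cone_measure_eq_scaled_hausdorff:
  fixes c :: "'a::euclidean_space"
  assumes DIM: "DIM('a) = Suc k" and k: "k \<ge> 1" and r: "r > 0"
  shows "cone_measure c r
    = scale_measure (emeasure lborel (ball c r) / hausdorff_outer k (sphere c r)) (sphere_hausdorff k c r)"
proof (rule finite_measure_eqI_uniform[where K="sphere c r"])
  let ?s = "emeasure lborel (ball c r) / hausdorff_outer k (sphere c r)"
  let ?N = "sphere_hausdorff k c r"
  have h: "hausdorff_outer k (sphere c r) \<noteq> 0" "hausdorff_outer k (sphere c r) \<noteq> top"
    using hausdorff_outer_sphere_pos[OF DIM k r, of c] hausdorff_outer_sphere_finite[OF DIM r, of c] by auto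
  have N: "emeasure ?N UNIV = hausdorff_outer k (sphere c r)" by (simp add: emeasure_sphere_hausdorff)
  have b: "0 < emeasure lborel (ball c r)" "emeasure lborel (ball c r) < top"
    using r by (simp_all add: emeasure_ball)
  have tot: "?s * hausdorff_outer k (sphere c r) = emeasure lborel (ball c r)"
    using h by (simp add: ennreal_divide_times divide_eq_1_ennreal ennreal_divide_self less_top)
  show "emeasure (cone_measure c r) UNIV = emeasure (scale_measure ?s ?N) UNIV"
    by (simp add: emeasure_cone_measure_UNIV N tot)
  show "emeasure (cone_measure c r) UNIV \<noteq> 0" using b by (simp add: emeasure_cone_measure_UNIV)
  show "finite_measure (cone_measure c r)"
    using b by (intro finite_measureI) (simp add: emeasure_cone_measure_UNIV)
  show "finite_measure (scale_measure ?s ?N)"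
    using b by (intro finite_measureI) (simp add: space_scale_measure N tot)
  show "AE x in cone_measure c r. x \<in> sphere c r" by (rule AE_cone_measure_sphere[OF r])
  show "AE x in scale_measure ?s ?N. x \<in> sphere c r"
  proof -
    obtain Z where "{x \<in> space ?N. \<not> x \<in> sphere c r} \<subseteq> Z" "emeasure ?N Z = 0" "Z \<in> sets ?N"
      by (rule AE_E[OF AE_sphere_hausdorff])
    then show ?thesis by (intro AE_I[of _ _ Z]) (simp_all add: space_scale_measure)
  qed
  show "emeasure (cone_measure c r) (ball x e) = emeasure (cone_measure c r) (ball y e)"
    if "x \<in> sphere c r" "y \<in> sphere c r" for x y e
    using that by (rule cone_measure_ball_unif)
  show "emeasure (scale_measure ?s ?N) (ball x e) = emeasure (scale_measure ?s ?N) (ball y e)"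
    if "x \<in> sphere c r" "y \<in> sphere c r" for x y e
    using sphere_hausdorff_ball_unif[OF that] by simp
qed auto

section \<open>Convex functions on a ball\<close>

text \<open>Lower integrals are monotone for arbitrary functions. This serves to compare a Borel
  function on the sphere with \<open>f\<close>, which may fail to be measurable there.\<close>

lemma ereal_integral_mono:
  assumes "\<And>x. x \<in> space M \<Longrightarrow> f x \<le> g x"
  shows "ereal_integral M f \<le> ereal_integral M g"
  unfolding ereal_integral_def
  by (intro ereal_minus_mono; simp add: less_eq_ennreal.rep_eq[symmetric])
     (auto intro!: nn_integral_mono ennreal_leI assms)

text \<open>Subtracting the lower bound reduces to a nonnegative integrand. If that integral is
  infinite, the positive part of \<open>f\<close> has infinite integral, while the negative part is
  at most \<open>\<bar>m\<bar>\<close> and the measure is finite, so no difference of infinities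
  occurs.\<close>

lemma ereal_integral_bounded_below:
  assumes fin: "finite_measure M" and f: "f \<in> borel_measurable M"
    and m: "\<And>x. x \<in> space M \<Longrightarrow> m \<le> f x"
  shows "ereal_integral M f
    = enn2ereal (\<integral>\<^sup>+x. ennreal (f x - m) \<partial>M) + ereal (m * measure M (space M))"
proof (cases "(\<integral>\<^sup>+x. ennreal (f x - m) \<partial>M) = \<infinity>")
  case True
  interpret finite_measure M by fact
  have const: "(\<integral>\<^sup>+x. ennreal \<bar>m\<bar> \<partial>M) < \<infinity>"
    by (simp add: ennreal_mult_eq_top_iff flip: less_top)
  have "(\<integral>\<^sup>+x. ennreal (- f x) \<partial>M) \<le> (\<integral>\<^sup>+x. ennreal \<bar>m\<bar> \<partial>M)"
    using m by (intro nn_integral_mono ennreal_leI) force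
  then have "(\<integral>\<^sup>+x. ennreal (- f x) \<partial>M) < \<infinity>" using const by (rule le_less_trans)
  moreover have "(\<integral>\<^sup>+x. ennreal (f x) \<partial>M) = \<infinity>"
  proof (rule ccontr)
    assume "(\<integral>\<^sup>+x. ennreal (f x) \<partial>M) \<noteq> \<infinity>"
    moreover have "(\<integral>\<^sup>+x. ennreal (f x - m) \<partial>M) \<le> (\<integral>\<^sup>+x. ennreal (f x) + ennreal \<bar>m\<bar> \<partial>M)"
    proof (intro nn_integral_mono)
      fix x
      have "ennreal (f x - m) \<le> ennreal (max 0 (f x) + \<bar>m\<bar>)" by (intro ennreal_leI) auto
      then show "ennreal (f x - m) \<le> ennreal (f x) + ennreal \<bar>m\<bar>"
        by (simp add: ennreal_plus ennreal_max_0)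
    qed
    ultimately show False using True const f
      by (auto simp: nn_integral_add top_unique)
  qed
  ultimately show ?thesis unfolding ereal_integral_def True
    by (cases "\<integral>\<^sup>+x. ennreal (- f x) \<partial>M") (auto simp: enn2ereal_ennreal)
next
  case False
  interpret finite_measure M by fact
  have int: "integrable M (\<lambda>x. f x - m)"
    using f m False by (intro integrableI_nonneg AE_I2) (auto simp: less_top)
  from Bochner_Integration.integrable_add[OF this, of "\<lambda>x. m"]
  have "integrable M f" by simp
  moreover have "integral\<^sup>L M f = integral\<^sup>L M (\<lambda>x. f x - m) + m * measure M (space M)"
    using \<open>integrable M f\<close> by simp
  moreover have "(\<integral>\<^sup>+x. ennreal (f x - m) \<partial>M) = ennreal (integral\<^sup>L M (\<lambda>x. f x - m))"
    using m by (intro nn_integral_eq_integral[OF int] AE_I2) auto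
  moreover have "0 \<le> integral\<^sup>L M (\<lambda>x. f x - m)"
    using m by (intro integral_nonneg_AE AE_I2) auto
  ultimately show ?thesis by (simp add: ereal_integral_eq_integral enn2ereal_ennreal)
qed

section \<open>Lower bounds, antipodal sums and radial limits of convex functions\<close>

text \<open>Continuity is available only in the interior, so \<open>y\<close> is compared with a
  point \<open>z\<close> opposite to it in the half-size ball, where \<open>f\<close> is bounded
  above. The centre is a convex combination of the two, which bounds \<open>f y\<close> from
  below.\<close>

lemma convex_on_cball_bounded_below:
  fixes f :: "'a::euclidean_space \<Rightarrow> real"
  assumes f: "convex_on (cball c r) f" and r: "r > 0"
  obtains m where "\<And>y. y \<in> cball c r \<Longrightarrow> m \<le> f y"
proof -
  have "convex_on (ball c r) f" by (rule convex_on_subset[OF f]) auto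
  then have "continuous_on (ball c r) f" by (rule convex_on_continuous[OF open_ball])
  moreover have "cball c (r / 2) \<subseteq> ball c r" using r by auto
  ultimately have "continuous_on (cball c (r / 2)) f" by (rule continuous_on_subset)
  moreover have "cball c (r / 2) \<noteq> {}" using r by simp
  ultimately obtain q where q: "\<And>z. z \<in> cball c (r / 2) \<Longrightarrow> f z \<le> f q"
    using continuous_attains_sup[OF compact_cball] by metis
  have "3 * f c - 2 * f q \<le> f y" if y: "y \<in> cball c r" for y
  proof -
    \<comment> \<open>The factor \<open>1 / 2\<close> puts \<open>z\<close> into the half-size ball
      and makes the weights \<open>1 / 3\<close> and \<open>2 / 3\<close>.\<close>
    define z where "z = c - (1 / 2) *\<^sub>R (y - c)"
    have z: "z \<in> cball c (r / 2)" using y by (simp add: z_def dist_norm norm_minus_commute)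
    then have "z \<in> cball c r" using r by (auto simp: dist_norm)
    have "(1 / 3) *\<^sub>R y + (2 / 3) *\<^sub>R z = (1 / 3 + 2 / 3) *\<^sub>R c + (1 / 3 - (2 / 3) * (1 / 2)) *\<^sub>R (y - c)"
      by (simp add: z_def algebra_simps flip: scaleR_add_left)
    then have "c = (1 / 3) *\<^sub>R y + (2 / 3) *\<^sub>R z" by simp
    then have "f c \<le> (1 / 3) * f y + (2 / 3) * f z"
      using convex_onD[OF f, of "2 / 3" y z] y \<open>z \<in> cball c r\<close> by simp
    then show ?thesis using q[OF z] by simp
  qed
  then show ?thesis by (rule that)
qed

text \<open>The sum is an even convex function of \<open>t\<close>, hence nondecreasing for
  \<open>t \<ge> 0\<close>. The weight \<open>l\<close> satisfies \<open>1 - 2 * l = t / s\<close>,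
  so the inner points are the combinations of the outer ones with weights \<open>1 - l\<close> and
  \<open>l\<close>.\<close>

lemma convex_on_symmetric_sum_mono:
  fixes f :: "'a::real_vector \<Rightarrow> real"
  assumes f: "convex_on A f" and A: "c + s *\<^sub>R v \<in> A" "c - s *\<^sub>R v \<in> A" and t: "0 \<le> t" "t \<le> s" "0 < s"
  shows "f (c + t *\<^sub>R v) + f (c - t *\<^sub>R v) \<le> f (c + s *\<^sub>R v) + f (c - s *\<^sub>R v)"
proof -
  define l where "l = (1 - t / s) / 2"
  have "0 \<le> t / s" "t / s \<le> 1" using t by auto
  then have l: "0 \<le> l" "l \<le> 1" by (auto simp: l_def)
  have "(1 - 2 * l) * s = t" using t by (simp add: l_def field_simps)
  then have eq: "t *\<^sub>R v = (1 - l) *\<^sub>R s *\<^sub>R v - l *\<^sub>R s *\<^sub>R v"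
    by (simp add: algebra_simps flip: scaleR_diff_left scaleR_add_left)
  have "c + t *\<^sub>R v = (1 - l) *\<^sub>R (c + s *\<^sub>R v) + l *\<^sub>R (c - s *\<^sub>R v)"
    "c - t *\<^sub>R v = (1 - l) *\<^sub>R (c - s *\<^sub>R v) + l *\<^sub>R (c + s *\<^sub>R v)"
    unfolding eq by (simp_all add: algebra_simps)
  then have "f (c + t *\<^sub>R v) \<le> (1 - l) * f (c + s *\<^sub>R v) + l * f (c - s *\<^sub>R v)"
    "f (c - t *\<^sub>R v) \<le> (1 - l) * f (c - s *\<^sub>R v) + l * f (c + s *\<^sub>R v)"
    using convex_onD[OF f l A] convex_onD[OF f l A(2,1)] by simp_all
  then show ?thesis by (simp add: algebra_simps)
qed

text \<open>On the sphere \<open>f\<close> may jump upwards and be non-measurable. Its upper limit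
  along a sequence of concentric spheres is Borel, is at most \<open>f\<close> by convexity along
  radii, and inherits the inequality for antipodal sums by subadditivity of
  \<open>limsup\<close>.\<close>

lemma convex_on_cball_sphere_trace:
  fixes f :: "'a::euclidean_space \<Rightarrow> real"
  assumes f: "convex_on (cball c r) f" and r: "r > 0" and m: "\<And>y. y \<in> cball c r \<Longrightarrow> m \<le> f y"
  obtains g where "g \<in> borel_measurable borel"
    "\<And>x. x \<in> sphere c r \<Longrightarrow> m \<le> g x \<and> g x \<le> f x"
    "\<And>x t. x \<in> sphere c r \<Longrightarrow> 0 \<le> t \<Longrightarrow> t < 1 \<Longrightarrow>
      f (c + t *\<^sub>R (x - c)) + f (c - t *\<^sub>R (x - c)) \<le> g x + g (c - (x - c))"
proof -
  \<comment> \<open>The double \<open>Suc\<close> starts the sequence at \<open>1 / 2\<close>, so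
    that every radius is positive.\<close>
  define s :: "nat \<Rightarrow> real" where "s n = 1 - inverse (real (Suc (Suc n)))" for n
  have s: "0 < s n" "s n < 1" for n
    using inverse_less_1_iff[of "real (Suc (Suc n))"] by (auto simp: s_def)
  have s_lim: "s \<longlonglongrightarrow> 1"
    unfolding s_def[abs_def]
    using tendsto_diff[OF tendsto_const[of 1] LIMSEQ_Suc[OF LIMSEQ_inverse_real_of_nat]] by simp
  define f0 where "f0 y = (if y \<in> ball c r then f y else 0)" for y
  have "convex_on (ball c r) f" by (rule convex_on_subset[OF f]) auto
  then have f0 [measurable]: "f0 \<in> borel_measurable borel"
    unfolding f0_def[abs_def]
    by (intro borel_measurable_continuous_on_if convex_on_continuous[OF open_ball] continuous_on_const) auto
  define G where "G x = limsup (\<lambda>n. ereal (f0 (c + s n *\<^sub>R (x - c))))" for x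
  \<comment> \<open>On the sphere \<open>G\<close> lies between \<open>m\<close> and
    \<open>f\<close>, so it is finite there and the conversion to a real loses nothing.\<close>
  define g where "g x = real_of_ereal (G x)" for x
  have [measurable]: "(\<lambda>x. f0 (c + s n *\<^sub>R (x - c))) \<in> borel_measurable borel" for n by measurable
  have g_meas: "g \<in> borel_measurable borel" unfolding g_def[abs_def] G_def[abs_def] by measurable
  have inball: "c + t *\<^sub>R (x - c) \<in> ball c r" "c - t *\<^sub>R (x - c) \<in> ball c r"
    if "x \<in> sphere c r" "0 \<le> t" "t < 1" for x t
    using that r by (auto simp: dist_norm norm_minus_commute)
  have f0s: "f0 (c + s n *\<^sub>R (x - c)) = f (c + s n *\<^sub>R (x - c))" if "x \<in> sphere c r" for x n
    using inball(1)[OF that, of "s n"] s[of n] by (simp add: f0_def)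
  have lower: "ereal m \<le> G x" if x: "x \<in> sphere c r" for x
    unfolding G_def
  proof (intro le_Limsup always_eventually allI)
    show "ereal m \<le> ereal (f0 (c + s n *\<^sub>R (x - c)))" for n
      unfolding f0s[OF x] using inball(1)[OF x, of "s n"] s[of n] m by (simp add: less_imp_le)
  qed simp
  have upper: "G x \<le> ereal (f x)" if x: "x \<in> sphere c r" for x
  proof -
    have xc: "x \<in> cball c r" "c \<in> cball c r" using x r by auto
    have le: "f0 (c + s n *\<^sub>R (x - c)) \<le> (1 - s n) * f c + s n * f x" for n
    proof -
      have "c + s n *\<^sub>R (x - c) = (1 - s n) *\<^sub>R c + s n *\<^sub>R x" by (simp add: algebra_simps)
      then show ?thesis unfolding f0s[OF x] using convex_onD[OF f _ _ xc(2,1), of "s n"] s[of n] by simp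
    qed
    have "G x \<le> limsup (\<lambda>n. ereal ((1 - s n) * f c + s n * f x))"
      unfolding G_def by (intro Limsup_mono always_eventually allI) (simp add: le)
    also have "\<dots> = ereal ((1 - 1) * f c + 1 * f x)"
      by (intro lim_imp_Limsup tendsto_ereal tendsto_intros s_lim) simp
    finally show ?thesis by simp
  qed
  have G: "G x = ereal (g x)" if "x \<in> sphere c r" for x
    using lower[OF that] upper[OF that] by (cases "G x") (auto simp: g_def)
  show ?thesis
  proof
    show "g \<in> borel_measurable borel" by (rule g_meas)
    show "m \<le> g x \<and> g x \<le> f x" if "x \<in> sphere c r" for x
      using lower[OF that] upper[OF that] by (simp add: G[OF that])
    fix x and t :: real assume x: "x \<in> sphere c r" and t: "0 \<le> t" "t < 1"
    have x': "c - (x - c) \<in> sphere c r" using x by (simp add: dist_norm norm_minus_commute)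
    have "\<forall>\<^sub>F n in sequentially. t < s n" using order_tendstoD(1)[OF s_lim t(2)] .
    then have ev: "\<forall>\<^sub>F n in sequentially. ereal (f (c + t *\<^sub>R (x - c)) + f (c - t *\<^sub>R (x - c)))
        \<le> ereal (f0 (c + s n *\<^sub>R (x - c))) + ereal (f0 (c + s n *\<^sub>R (c - (x - c) - c)))"
    proof eventually_elim
      case (elim n)
      have "c + s n *\<^sub>R (c - (x - c) - c) = c - s n *\<^sub>R (x - c)"
        by (simp add: algebra_simps)
      then show ?case unfolding f0s[OF x] f0s[OF x']
        using convex_on_symmetric_sum_mono[OF f, of c "s n" "x - c" t] elim t s[of n]
          inball[OF x, of "s n"] by (simp add: less_imp_le)
    qed
    have "ereal (f (c + t *\<^sub>R (x - c)) + f (c - t *\<^sub>R (x - c)))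
        \<le> limsup (\<lambda>n. ereal (f0 (c + s n *\<^sub>R (x - c))) + ereal (f0 (c + s n *\<^sub>R (c - (x - c) - c))))"
      by (rule le_Limsup[OF _ ev]) simp
    also have "\<dots> \<le> G x + G (c - (x - c))"
      unfolding G_def by (rule ereal_limsup_add_mono)
    also have "\<dots> = ereal (g x + g (c - (x - c)))" by (simp add: G[OF x] G[OF x'])
    finally show "f (c + t *\<^sub>R (x - c)) + f (c - t *\<^sub>R (x - c)) \<le> g x + g (c - (x - c))" by simp
  qed
qed

section \<open>Comparison of integrals over the ball and over the sphere\<close>

text \<open>Point reflection in \<open>c\<close> preserves Lebesgue measure and the ball, so
  averaging the pointwise inequality over \<open>y\<close> and its mirror image doubles each
  side.\<close>

lemma nn_integral_ball_le_cone_measure: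
  fixes c :: "'a::euclidean_space" and F G :: "'a \<Rightarrow> ennreal"
  assumes r: "r > 0" and [measurable]: "F \<in> borel_measurable borel" "G \<in> borel_measurable borel"
    and le: "\<And>x t. x \<in> sphere c r \<Longrightarrow> 0 \<le> t \<Longrightarrow> t < 1 \<Longrightarrow>
      F (c + t *\<^sub>R (x - c)) + F (c - t *\<^sub>R (x - c)) \<le> G x + G (c - (x - c))"
  shows "(\<integral>\<^sup>+y. F y * indicator (ball c r) y \<partial>lborel) \<le> (\<integral>\<^sup>+x. G x \<partial>cone_measure c r)"
proof -
  define T where "T y = c - (y - c)" for y
  have T: "T (T y) = y" "dist (T y) (T z) = dist y z" for y z
    by (simp_all add: T_def dist_norm norm_minus_commute)
  have [measurable]: "ball c r \<in> sets borel" by simp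
  have [measurable]: "T \<in> borel_measurable borel" unfolding T_def[abs_def] by measurable
  have refl: "(\<integral>\<^sup>+y. h (T y) * indicator (ball c r) y \<partial>lborel) = (\<integral>\<^sup>+y. h y * indicator (ball c r) y \<partial>lborel)"
    if [measurable]: "h \<in> borel_measurable borel" for h :: "'a \<Rightarrow> ennreal"
  proof -
    have "(\<integral>\<^sup>+y. h y * indicator (ball c r) y \<partial>lborel) = (\<integral>\<^sup>+y. h y * indicator (ball c r) y \<partial>distr lborel borel T)"
      by (simp add: distr_lborel_isometric_involution[OF T])
    also have "\<dots> = (\<integral>\<^sup>+y. h (T y) * indicator (ball c r) (T y) \<partial>lborel)"
      by (intro nn_integral_distr) measurable
    also have "\<dots> = (\<integral>\<^sup>+y. h (T y) * indicator (ball c r) y \<partial>lborel)"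
      by (intro nn_integral_cong) (simp add: T_def indicator_def dist_norm norm_minus_commute)
    finally show ?thesis ..
  qed
  have rT: "radial c r (T y) = T (radial c r y)" for y
    by (simp add: radial_def T_def norm_minus_commute algebra_simps)
  let ?A = "\<integral>\<^sup>+y. F y * indicator (ball c r) y \<partial>lborel"
  let ?B = "\<integral>\<^sup>+y. G (radial c r y) * indicator (ball c r) y \<partial>lborel"
  have "?A + ?A = (\<integral>\<^sup>+y. F y * indicator (ball c r) y + F (T y) * indicator (ball c r) y \<partial>lborel)"
    by (subst nn_integral_add) (auto simp: refl)
  also have "\<dots> \<le> (\<integral>\<^sup>+y. G (radial c r y) * indicator (ball c r) y
      + G (radial c r (T y)) * indicator (ball c r) y \<partial>lborel)"
  proof (rule nn_integral_mono_AE)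
    have "F y * indicator (ball c r) y + F (T y) * indicator (ball c r) y
      \<le> G (radial c r y) * indicator (ball c r) y + G (radial c r (T y)) * indicator (ball c r) y"
      \<comment> \<open>The centre has no radial projection onto the sphere; it is a null
        set.\<close>
      if "y \<noteq> c" for y
    proof (cases "y \<in> ball c r")
      case True
      define t where "t = norm (y - c) / r"
      have t: "0 \<le> t" "t < 1" using True r by (auto simp: t_def dist_norm norm_minus_commute)
      have y: "y = c + t *\<^sub>R (radial c r y - c)" unfolding t_def by (rule radial_polar[OF r])
      then have Ty: "T y = c - t *\<^sub>R (radial c r y - c)" unfolding T_def by (metis add_diff_cancel_left')
      have "F y + F (T y) \<le> G (radial c r y) + G (radial c r (T y))"
        using le[OF radial_in_sphere[OF r that] t] unfolding y[symmetric] Ty[symmetric] rT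
        by (simp add: T_def)
      then show ?thesis using True by simp
    qed simp
    then show "AE y in lborel. F y * indicator (ball c r) y + F (T y) * indicator (ball c r) y
      \<le> G (radial c r y) * indicator (ball c r) y + G (radial c r (T y)) * indicator (ball c r) y"
      using AE_lborel_singleton[of c] by auto
  qed
  also have "\<dots> = ?B + ?B"
    by (subst nn_integral_add) (auto simp: refl[of "\<lambda>y. G (radial c r y)"])
  finally have "2 * ?A \<le> 2 * ?B" by (simp add: mult_2)
  then have "?A \<le> ?B" by (subst (asm) ennreal_mult_le_mult_iff) auto
  then show ?thesis by (simp add: nn_integral_cone_measure)
qed

theorem proposition2:
  fixes c :: "'a::euclidean_space" and r :: real
  assumes "DIM('a) \<ge> 2" and "r > 0"
  shows "jensen_type (cball c r)"
proof -
  define k where "k = DIM('a) - 1"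
  have k: "DIM('a) = Suc k" "k \<ge> 1" using assms(1) by (auto simp: k_def)
  note r = assms(2)
  let ?S = "sphere c r"
  let ?H = "restrict_space (hausdorff_measure k) ?S"
  define V where "V = measure lebesgue (cball c r)"
  have V: "V > 0" "emeasure lborel (ball c r) = ennreal V"
    using r by (simp_all add: V_def content_cball emeasure_ball)
  define h where "h = measure (hausdorff_measure k) ?S"
  have emeasure_S: "emeasure (hausdorff_measure k) ?S = hausdorff_outer k ?S"
    by (rule emeasure_hausdorff_measure[OF sphere_in_sets_hausdorff])
  have h: "h > 0" "hausdorff_outer k ?S = ennreal h"
    using hausdorff_outer_sphere_pos[OF k r, of c] hausdorff_outer_sphere_finite[OF k(1) r, of c]
    by (auto simp: h_def measure_def emeasure_S enn2real_positive_iff)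
  have "ereal (1 / V) * ereal_integral (lebesgue_on (cball c r)) f \<le> ereal (1 / h) * ereal_integral ?H f"
    if f: "convex_on (cball c r) f" for f
  proof -
    obtain m where m: "\<And>y. y \<in> cball c r \<Longrightarrow> m \<le> f y"
      using convex_on_cball_bounded_below[OF f r] by blast
    obtain g where g: "g \<in> borel_measurable borel"
      and gf: "\<And>x. x \<in> ?S \<Longrightarrow> m \<le> g x \<and> g x \<le> f x"
      and sum: "\<And>x t. x \<in> ?S \<Longrightarrow> 0 \<le> t \<Longrightarrow> t < 1 \<Longrightarrow>
        f (c + t *\<^sub>R (x - c)) + f (c - t *\<^sub>R (x - c)) \<le> g x + g (c - (x - c))"
      using convex_on_cball_sphere_trace[OF f r m] by metis
    \<comment> \<open>With the value \<open>m\<close> outside the open ball, \<open>f0\<close> is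
      Borel and \<open>f0 - m\<close> vanishes on the sphere, so its integrals over the open and the
      closed ball coincide.\<close>
    define f0 where "f0 y = (if y \<in> ball c r then f y else m)" for y
    have "convex_on (ball c r) f" by (rule convex_on_subset[OF f]) auto
    then have f0: "f0 \<in> borel_measurable borel"
      unfolding f0_def[abs_def]
      by (intro borel_measurable_continuous_on_if convex_on_continuous[OF open_ball] continuous_on_const) auto
    have f0m: "m \<le> f0 y" for y using m[of y] by (auto simp: f0_def)
    define A where "A = (\<integral>\<^sup>+y. ennreal (f0 y - m) * indicator (ball c r) y \<partial>lborel)"
    define B where "B = (\<integral>\<^sup>+x. ennreal (g x - m) \<partial>?H)"
    have "A \<le> (\<integral>\<^sup>+x. ennreal (g x - m) \<partial>cone_measure c r)"
      unfolding A_def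
    proof (rule nn_integral_ball_le_cone_measure[OF r])
      fix x t assume x: "x \<in> ?S" and t: "0 \<le> t" "t < (1::real)"
      have x': "c - (x - c) \<in> ?S" using x by (simp add: dist_norm norm_minus_commute)
      have "c + t *\<^sub>R (x - c) \<in> ball c r" "c - t *\<^sub>R (x - c) \<in> ball c r"
        using x t r by (auto simp: dist_norm norm_minus_commute)
      then have "(f0 (c + t *\<^sub>R (x - c)) - m) + (f0 (c - t *\<^sub>R (x - c)) - m)
          \<le> (g x - m) + (g (c - (x - c)) - m)"
        using sum[OF x t] by (simp add: f0_def)
      then show "ennreal (f0 (c + t *\<^sub>R (x - c)) - m) + ennreal (f0 (c - t *\<^sub>R (x - c)) - m)
          \<le> ennreal (g x - m) + ennreal (g (c - (x - c)) - m)"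
        using f0m gf[OF x] gf[OF x'] by (simp add: ennreal_leI flip: ennreal_plus)
    qed (use f0 g in measurable)
    also have "\<dots> = (ennreal V / ennreal h) * B"
      using g unfolding cone_measure_eq_scaled_hausdorff[OF k r] V(2) h(2) B_def
      by (subst nn_integral_scale_measure) (auto simp: nn_integral_sphere_hausdorff)
    also have "ennreal V / ennreal h = ennreal (V / h)" using V h by (simp add: divide_ennreal)
    finally have AB: "A \<le> ennreal (V / h) * B" .

    have "ereal_integral (lebesgue_on (cball c r)) f = ereal_integral (lebesgue_on (cball c r)) f0"
    proof -
      \<comment> \<open>\<open>f\<close> and \<open>f0\<close> differ in the closed ball at most on
        the sphere, a Lebesgue null set.\<close>
      have "AE y in lebesgue. y \<notin> ?S"
        using negligible_sphere[of c r] unfolding negligible_iff_null_sets by (rule AE_not_in)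
      then have "AE y in lebesgue_on (cball c r). f y = f0 y"
        by (subst AE_restrict_space_iff) (auto simp: f0_def)
      then show ?thesis unfolding ereal_integral_def
        by (intro arg_cong2[where f="(-)"] arg_cong[where f=enn2ereal] nn_integral_cong_AE) auto
    qed
    also have "\<dots> = enn2ereal (\<integral>\<^sup>+y. ennreal (f0 y - m) \<partial>lebesgue_on (cball c r))
        + ereal (m * measure (lebesgue_on (cball c r)) (space (lebesgue_on (cball c r))))"
    proof (rule ereal_integral_bounded_below)
      show "finite_measure (lebesgue_on (cball c r))"
        by (rule finite_measure_lebesgue_on) simp
      have "f0 \<in> borel_measurable lebesgue" using f0 by (simp add: measurable_completion)
      then show "f0 \<in> borel_measurable (lebesgue_on (cball c r))" by (rule measurable_restrict_space1)
    qed (rule f0m)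
    also have "measure (lebesgue_on (cball c r)) (space (lebesgue_on (cball c r))) = V"
      by (simp add: measure_restrict_space V_def)
    also have "(\<integral>\<^sup>+y. ennreal (f0 y - m) \<partial>lebesgue_on (cball c r)) = A"
    proof -
      have "(\<integral>\<^sup>+y. ennreal (f0 y - m) \<partial>lebesgue_on (cball c r))
          = (\<integral>\<^sup>+y. ennreal (f0 y - m) * indicator (cball c r) y \<partial>lebesgue)"
        by (rule nn_integral_restrict_space) simp
      also have "\<dots> = (\<integral>\<^sup>+y. ennreal (f0 y - m) * indicator (ball c r) y \<partial>lebesgue)"
        by (intro nn_integral_cong) (auto simp: f0_def indicator_def)
      finally show ?thesis by (simp add: A_def nn_integral_completion)
    qed
    finally have left: "ereal_integral (lebesgue_on (cball c r)) f = enn2ereal A + ereal (m * V)" .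

    have spH: "space ?H = ?S" by (simp add: space_restrict_space)
    have "ereal_integral ?H g = enn2ereal B + ereal (m * measure ?H (space ?H))"
      unfolding B_def
    proof (rule ereal_integral_bounded_below)
      show "finite_measure ?H"
        by (intro finite_measureI)
          (simp add: spH emeasure_restrict_space sphere_in_sets_hausdorff emeasure_S h)
    qed (use gf spH in \<open>auto intro: borel_measurable_restrict_hausdorff[OF g]\<close>)
    also have "measure ?H (space ?H) = h"
      unfolding spH h_def by (simp add: measure_restrict_space sphere_in_sets_hausdorff)
    finally have "ereal_integral ?H g = enn2ereal B + ereal (m * h)" .
    \<comment> \<open>Passing from \<open>g\<close> to \<open>f\<close> only increases the
      right-hand side and requires no measurability of \<open>f\<close>.\<close>
    moreover have "ereal_integral ?H g \<le> ereal_integral ?H f"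
      by (rule ereal_integral_mono) (use gf spH in auto)
    ultimately have right: "enn2ereal B + ereal (m * h) \<le> ereal_integral ?H f" by simp

    \<comment> \<open>After division by the total masses both sides contain the same constant
      \<open>m\<close>, and \<open>AB\<close> compares the rest. If \<open>B\<close> is infinite, so
      is the right-hand side; otherwise \<open>A\<close> is finite as well.\<close>
    have "ereal (1 / V) * (enn2ereal A + ereal (m * V)) \<le> ereal (1 / h) * (enn2ereal B + ereal (m * h))"
    proof (cases B)
      case (real b)
      have "A \<le> ennreal (V / h * b)"
        using AB real V h by (metis ennreal_mult divide_nonneg_pos less_imp_le)
      then obtain a where a: "A = ennreal a" "0 \<le> a" "a \<le> V / h * b"
        using real V h by (cases A) (auto simp: top_unique)
      have "a / V \<le> b / h" using a(3) V h by (simp add: field_simps)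
      then show ?thesis using V h by (simp add: a real enn2ereal_ennreal distrib_left)
    next
      case top
      then show ?thesis using h by simp
    qed
    also have "\<dots> \<le> ereal (1 / h) * ereal_integral ?H f"
      using right h by (intro ereal_mult_left_mono) auto
    finally show ?thesis unfolding left .
  qed
  moreover have "frontier (cball c r) = ?S" using r by (simp add: frontier_cball)
  ultimately show ?thesis
    by (simp add: jensen_type_def V_def h_def k_def)
qed

end
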